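(* Let $X$ be an $n$-dimensional complex manifold with Hermitian metric $h$, and let $LX=W^{k,2}(\mathbb{S}^1,X)$, $k\ge 1$, be equipped with the Hermitian metric $$H_g(\xi,\eta)=\int_{\mathbb{S}^1}h_{g(s)}\big(\xi(s),\eta(s)\big)\,ds,\qquad g\in LX,\ \xi,\eta\in T_g(LX).$$ If $(X,h)$ is Kähler, then $(LX,H)$ is Kähler as well, i.e. the form $\Omega=-\mathrm{Im}(H)$ on $LX$ satisfies $d\Omega=0$.
   Context: $LX=W^{k,2}(\mathbb{S}^1,X)$ is the Sobolev loop space of $X$, viewed as a complex Hilbert manifold with $T_g(LX)=W^{k,2}(\mathbb{S}^1,g^*TX)$. $ds$ is a fixed rotation-invariant measure on $\mathbb{S}^1$. $(X,h)$ is Kähler if $\omega=-\mathrm{Im}(h)$ is closed. The form associated with $H$ is $\Omega_g(\xi,\eta)=\int_{\mathbb{S}^1}\omega_{g(s)}(\xi(s),\eta(s))\,ds$, and $(LX,H)$ is called Kähler if $d\Omega=0$, where $d$ is the exterior differential on $LX$. *)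

theory Defs
  imports "HOL-Analysis.Analysis"
begin

section \<open>Smooth and holomorphic maps, closed two-forms\<close>

text \<open>For open \<open>S\<close> in a finite-dimensional space, \<open>Ck_on m S f\<close> says that \<open>f\<close> is of class
  \<open>C\<^sup>m\<close> on \<open>S\<close>.\<close>

fun Ck_on :: "nat \<Rightarrow> 'a::real_normed_vector set \<Rightarrow> ('a \<Rightarrow> 'b::real_normed_vector) \<Rightarrow> bool" where
  "Ck_on 0 S f \<longleftrightarrow> continuous_on S f"
| "Ck_on (Suc m) S f \<longleftrightarrow>
     (\<forall>x\<in>S. f differentiable (at x)) \<and> (\<forall>v. Ck_on m S (\<lambda>x. frechet_derivative f (at x) v))"

definition smooth_on :: "'a::real_normed_vector set \<Rightarrow> ('a \<Rightarrow> 'b::real_normed_vector) \<Rightarrow> bool" where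
  "smooth_on S f \<longleftrightarrow> (\<forall>m. Ck_on m S f)"

definition holomorphic_map_on ::
    "(complex^'m) set \<Rightarrow> (complex^'m \<Rightarrow> complex^'n) \<Rightarrow> bool" where
  "holomorphic_map_on S f \<longleftrightarrow>
     (\<forall>z\<in>S. \<exists>D. (f has_derivative D) (at z) \<and> (\<forall>c v. D (c *s v) = c *s D v))"

text \<open>Exterior derivative of a two-form \<open>B\<close> on an open subset of a normed space, evaluated on
  constant vector fields (so that the Lie bracket terms vanish).\<close>

definition ext_deriv2 ::
    "('e::real_normed_vector \<Rightarrow> 'e \<Rightarrow>\<^sub>L 'e \<Rightarrow>\<^sub>L real) \<Rightarrow> 'e \<Rightarrow> 'e \<Rightarrow> 'e \<Rightarrow> 'e \<Rightarrow> real" where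
  "ext_deriv2 B u a b c =
     blinfun_apply (blinfun_apply (frechet_derivative B (at u) a) b) c
   - blinfun_apply (blinfun_apply (frechet_derivative B (at u) b) a) c
   + blinfun_apply (blinfun_apply (frechet_derivative B (at u) c) a) b"

text \<open>\<open>\<alpha>\<close> is a two-form on the open set \<open>U\<close>, given pointwise; being closed includes that it takes
  values in the bounded bilinear forms and is Frechet differentiable as such.\<close>

definition closed_2form_on ::
    "'e::real_normed_vector set \<Rightarrow> ('e \<Rightarrow> 'e \<Rightarrow> 'e \<Rightarrow> real) \<Rightarrow> bool" where
  "closed_2form_on U \<alpha> \<longleftrightarrow>
     (\<exists>B. (\<forall>u\<in>U. \<forall>a b. blinfun_apply (blinfun_apply (B u) a) b = \<alpha> u a b) \<and>
          (\<forall>u\<in>U. B differentiable (at u)) \<and>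
          (\<forall>u\<in>U. \<forall>a b c. ext_deriv2 B u a b c = 0))"


section \<open>Complex manifolds and Hermitian metrics\<close>

type_synonym ('x, 'n) chart = "'x set \<times> ('x \<Rightarrow> complex^'n)"

definition chart_inv :: "('x, 'n) chart \<Rightarrow> complex^'n \<Rightarrow> 'x" where
  "chart_inv c = inv_into (fst c) (snd c)"

definition transition :: "('x, 'n) chart \<Rightarrow> ('x, 'n) chart \<Rightarrow> complex^'n \<Rightarrow> complex^'n" where
  "transition c c' = snd c' \<circ> chart_inv c"

definition complex_manifold ::
    "('x::{t2_space, second_countable_topology}, 'n::finite) chart set \<Rightarrow> bool" where
  "complex_manifold A \<longleftrightarrow>
     (\<Union>c\<in>A. fst c) = UNIV \<and>
     (\<forall>c\<in>A. open (fst c) \<and> open (snd c ` fst c) \<and>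
        homeomorphism (fst c) (snd c ` fst c) (snd c) (chart_inv c)) \<and>
     (\<forall>c\<in>A. \<forall>c'\<in>A. holomorphic_map_on (snd c ` (fst c \<inter> fst c')) (transition c c'))"

text \<open>A tangent vector at \<open>x\<close> is the family of its coordinate vectors in all charts around \<open>x\<close>,
  extended by \<open>0\<close> to the other charts.\<close>

type_synonym ('x, 'n) tvec = "('x, 'n) chart \<Rightarrow> complex^'n"

definition tangent_space ::
    "('x, 'n::finite) chart set \<Rightarrow> 'x \<Rightarrow> ('x, 'n) tvec set" where
  "tangent_space A x =
     {v. (\<forall>c\<in>A. \<forall>c'\<in>A. x \<in> fst c \<inter> fst c' \<longrightarrow>
            v c' = frechet_derivative (transition c c') (at (snd c x)) (v c)) \<and>
         (\<forall>c. c \<notin> A \<or> x \<notin> fst c \<longrightarrow> v c = 0)}"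

definition tvec_of_coords ::
    "('x, 'n::finite) chart set \<Rightarrow> ('x, 'n) chart \<Rightarrow> 'x \<Rightarrow> complex^'n \<Rightarrow> ('x, 'n) tvec" where
  "tvec_of_coords A c x a =
     (\<lambda>c'. if c' \<in> A \<and> x \<in> fst c'
           then frechet_derivative (transition c c') (at (snd c x)) a else 0)"

definition hermitian_metric ::
    "('x, 'n::finite) chart set \<Rightarrow> ('x \<Rightarrow> ('x, 'n) tvec \<Rightarrow> ('x, 'n) tvec \<Rightarrow> complex) \<Rightarrow> bool" where
  "hermitian_metric A h \<longleftrightarrow>
     (\<forall>x. \<forall>u\<in>tangent_space A x. \<forall>v\<in>tangent_space A x. \<forall>w\<in>tangent_space A x.
        h x (\<lambda>c. u c + v c) w = h x u w + h x v w) \<and>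
     (\<forall>x. \<forall>u\<in>tangent_space A x. \<forall>v\<in>tangent_space A x. \<forall>a.
        h x (\<lambda>c. a *s u c) v = a * h x u v) \<and>
     (\<forall>x. \<forall>u\<in>tangent_space A x. \<forall>v\<in>tangent_space A x. h x v u = cnj (h x u v)) \<and>
     (\<forall>x. \<forall>u\<in>tangent_space A x. u \<noteq> (\<lambda>c. 0) \<longrightarrow> 0 < Re (h x u u)) \<and>
     (\<forall>c\<in>A. \<forall>a b. smooth_on (snd c ` fst c)
        (\<lambda>z. let x = chart_inv c z in h x (tvec_of_coords A c x a) (tvec_of_coords A c x b)))"

definition fundamental_form ::
    "('p \<Rightarrow> 'v \<Rightarrow> 'v \<Rightarrow> complex) \<Rightarrow> 'p \<Rightarrow> 'v \<Rightarrow> 'v \<Rightarrow> real" where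
  "fundamental_form h x u v = - Im (h x u v)"

definition closed_2form ::
    "('x, 'n::finite) chart set \<Rightarrow> ('x \<Rightarrow> ('x, 'n) tvec \<Rightarrow> ('x, 'n) tvec \<Rightarrow> real) \<Rightarrow> bool" where
  "closed_2form A \<omega> \<longleftrightarrow>
     (\<forall>c\<in>A. closed_2form_on (snd c ` fst c)
        (\<lambda>z a b. let x = chart_inv c z in \<omega> x (tvec_of_coords A c x a) (tvec_of_coords A c x b)))"

definition kaehler ::
    "('x, 'n::finite) chart set \<Rightarrow> ('x \<Rightarrow> ('x, 'n) tvec \<Rightarrow> ('x, 'n) tvec \<Rightarrow> complex) \<Rightarrow> bool" where
  "kaehler A h \<longleftrightarrow> closed_2form A (fundamental_form h)"


section \<open>The circle\<close>

typedef circle = "sphere (0::complex) 1"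
  by (rule exI[of _ 1]) simp

instantiation circle :: metric_space
begin

definition dist_circle :: "circle \<Rightarrow> circle \<Rightarrow> real" where
  "dist_circle x y = dist (Rep_circle x) (Rep_circle y)"

definition uniformity_circle :: "(circle \<times> circle) filter" where
  "uniformity_circle = (INF e\<in>{0<..}. principal {(x, y). dist x y < e})"

definition open_circle :: "circle set \<Rightarrow> bool" where
  "open_circle U \<longleftrightarrow> (\<forall>x\<in>U. eventually (\<lambda>(x', y). x' = x \<longrightarrow> y \<in> U) uniformity)"

instance
  by standard
    (auto simp: dist_circle_def uniformity_circle_def open_circle_def Rep_circle_inject
      dist_triangle2)

end

definition circle_exp :: "real \<Rightarrow> circle" where
  "circle_exp \<theta> = Abs_circle (cis \<theta>)"

definition rotate_circle :: "circle \<Rightarrow> circle \<Rightarrow> circle" where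
  "rotate_circle r s = Abs_circle (Rep_circle r * Rep_circle s)"

definition rotation_invariant_measure :: "circle measure \<Rightarrow> bool" where
  "rotation_invariant_measure \<mu> \<longleftrightarrow>
     sets \<mu> = sets borel \<and> finite_measure \<mu> \<and> emeasure \<mu> (space \<mu>) \<noteq> 0 \<and>
     (\<forall>r. distr \<mu> \<mu> (rotate_circle r) = \<mu>)"


section \<open>Sobolev spaces on intervals and on the circle\<close>

text \<open>\<open>sobolev_derivs k a b f d\<close>: on \<open>[a, b]\<close> the function \<open>f\<close> has the weak derivatives
  \<open>d 0 = f, d 1, ..., d k\<close>, all of them in \<open>L\<^sup>2\<close>. In one dimension a weak derivative is
  characterised by the fundamental theorem of calculus; for \<open>j < k\<close> the derivative \<open>d j\<close> is the
  continuous representative.\<close>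

definition sobolev_derivs ::
    "nat \<Rightarrow> real \<Rightarrow> real \<Rightarrow> (real \<Rightarrow> 'a::euclidean_space) \<Rightarrow> (nat \<Rightarrow> real \<Rightarrow> 'a) \<Rightarrow> bool" where
  "sobolev_derivs k a b f d \<longleftrightarrow>
     (\<forall>t\<in>{a..b}. d 0 t = f t) \<and>
     (\<forall>j\<le>k. set_borel_measurable lborel {a..b} (d j) \<and>
        set_integrable lborel {a..b} (\<lambda>t. (norm (d j t))\<^sup>2)) \<and>
     (\<forall>j<k. \<forall>t\<in>{a..b}. d j t = d j a + (LBINT s:{a..t}. d (Suc j) s))"

definition sobolev_on :: "nat \<Rightarrow> real \<Rightarrow> real \<Rightarrow> (real \<Rightarrow> 'a::euclidean_space) \<Rightarrow> bool" where
  "sobolev_on k a b f \<longleftrightarrow> (\<exists>d. sobolev_derivs k a b f d)"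

definition sobolev_circle :: "nat \<Rightarrow> (circle \<Rightarrow> 'a::euclidean_space) \<Rightarrow> bool" where
  "sobolev_circle k f \<longleftrightarrow> (\<forall>a b. a < b \<longrightarrow> sobolev_on k a b (f \<circ> circle_exp))"

text \<open>The top derivative is determined only almost everywhere, which does not affect the inner
  product below.\<close>

definition weak_deriv :: "nat \<Rightarrow> (circle \<Rightarrow> 'a::euclidean_space) \<Rightarrow> nat \<Rightarrow> real \<Rightarrow> 'a" where
  "weak_deriv k f = (SOME d. sobolev_derivs k 0 (2 * pi) (f \<circ> circle_exp) d)"

definition sobolev_inner ::
    "nat \<Rightarrow> (circle \<Rightarrow> 'a::euclidean_space) \<Rightarrow> (circle \<Rightarrow> 'a) \<Rightarrow> real" where
  "sobolev_inner k f g =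
     (\<Sum>j\<le>k. LBINT t:{0..2 * pi}. weak_deriv k f j t \<bullet> weak_deriv k g j t)"

lemma sobolev_derivs_0:
  assumes "sobolev_derivs k a b f d" "t \<in> {a..b}"
  shows "d 0 t = f t"
  using assms unfolding sobolev_derivs_def by blast

lemma sobolev_derivs_meas:
  assumes "sobolev_derivs k a b f d" "j \<le> k"
  shows "set_borel_measurable lborel {a..b} (d j)"
    and "set_integrable lborel {a..b} (\<lambda>t. (norm (d j t))\<^sup>2)"
  using assms unfolding sobolev_derivs_def by blast+

lemma sobolev_derivs_ftc:
  assumes "sobolev_derivs k a b f d" "j < k" "t \<in> {a..b}"
  shows "d j t = d j a + (LBINT s:{a..t}. d (Suc j) s)"
  using assms unfolding sobolev_derivs_def by blast

lemma sobolev_derivs_integrable: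
  assumes "sobolev_derivs k a b f d" "j \<le> k"
  shows "set_integrable lborel {a..b} (d j)"
  unfolding set_integrable_def
proof (rule Bochner_Integration.integrable_bound)
  have 2: "set_integrable lborel {a..b} (\<lambda>t. (norm (d j t))\<^sup>2)"
    using assms by (rule sobolev_derivs_meas)
  have 1: "set_integrable lborel {a..b} (\<lambda>t. 1 :: real)"
    by (intro borel_integrable_atLeastAtMost' continuous_intros)
  from set_integral_add(1)[OF 1 2]
 show "integrable lborel (\<lambda>t. indicat_real {a..b} t *\<^sub>R (1 + (norm (d j t))\<^sup>2))"
    by (simp add: set_integrable_def)
  show "(\<lambda>t. indicat_real {a..b} t *\<^sub>R d j t) \<in> borel_measurable lborel"
    using sobolev_derivs_meas(1)[OF assms] by (simp add: set_borel_measurable_def)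
  have "x \<le> 1 + x\<^sup>2" for x :: real
    using zero_le_power2[of "x - 1/2"] by (simp add: power2_eq_square algebra_simps)
  then show "AE t in lborel. norm (indicat_real {a..b} t *\<^sub>R d j t)
      \<le> norm (indicat_real {a..b} t *\<^sub>R (1 + (norm (d j t))\<^sup>2))"
    by (auto simp: indicator_def)
qed

lemma set_integrable_inner_square:
  fixes f g :: "real \<Rightarrow> 'a::euclidean_space"
  assumes "set_borel_measurable lborel S f" "set_integrable lborel S (\<lambda>t. (norm (f t))\<^sup>2)"
    and "set_borel_measurable lborel S g" "set_integrable lborel S (\<lambda>t. (norm (g t))\<^sup>2)"
  shows "set_integrable lborel S (\<lambda>t. f t \<bullet> g t)"
  unfolding set_integrable_def
proof (rule Bochner_Integration.integrable_bound)
  show "integrable lborel (\<lambda>t. indicat_real S t *\<^sub>R ((norm (f t))\<^sup>2 + (norm (g t))\<^sup>2))"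
    using set_integral_add(1)[OF assms(2,4)] by (simp add: set_integrable_def)
  have "(\<lambda>t. (indicat_real S t *\<^sub>R f t) \<bullet> (indicat_real S t *\<^sub>R g t)) \<in> borel_measurable lborel"
    using assms(1,3) unfolding set_borel_measurable_def by (rule borel_measurable_inner)
  moreover have "(\<lambda>t. (indicat_real S t *\<^sub>R f t) \<bullet> (indicat_real S t *\<^sub>R g t))
      = (\<lambda>t. indicat_real S t *\<^sub>R (f t \<bullet> g t))"
    by (auto simp: indicator_def)
  ultimately show "(\<lambda>t. indicat_real S t *\<^sub>R (f t \<bullet> g t)) \<in> borel_measurable lborel" by simp
  have "\<bar>f t \<bullet> g t\<bar> \<le> (norm (f t))\<^sup>2 + (norm (g t))\<^sup>2" for t
  proof -
    have "\<bar>f t \<bullet> g t\<bar> \<le> norm (f t) * norm (g t)" by (rule Cauchy_Schwarz_ineq2)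
    also have "\<dots> \<le> (norm (f t))\<^sup>2 + (norm (g t))\<^sup>2"
      using sum_squares_bound[of "norm (f t)" "norm (g t)"]
        mult_nonneg_nonneg[OF norm_ge_zero norm_ge_zero, of "f t" "g t"] by linarith
    finally show ?thesis .
  qed
  then show "AE t in lborel. norm (indicat_real S t *\<^sub>R (f t \<bullet> g t))
      \<le> norm (indicat_real S t *\<^sub>R ((norm (f t))\<^sup>2 + (norm (g t))\<^sup>2))"
    by (auto simp: indicator_def)
qed

lemma sobolev_derivs_add:
  fixes f g :: "real \<Rightarrow> 'a::euclidean_space"
  assumes d: "sobolev_derivs k a b f d" and e: "sobolev_derivs k a b g e"
  shows "sobolev_derivs k a b (\<lambda>t. f t + g t) (\<lambda>j t. d j t + e j t)"
  unfolding sobolev_derivs_def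
proof (intro conjI allI impI ballI)
  fix t assume "t \<in> {a..b}"
  then show "d 0 t + e 0 t = f t + g t" using sobolev_derivs_0[OF d] sobolev_derivs_0[OF e] by simp
next
  fix j assume j: "j \<le> k"
  have md: "set_borel_measurable lborel {a..b} (d j)"
    and me: "set_borel_measurable lborel {a..b} (e j)"
    and id: "set_integrable lborel {a..b} (\<lambda>t. (norm (d j t))\<^sup>2)"
    and ie: "set_integrable lborel {a..b} (\<lambda>t. (norm (e j t))\<^sup>2)"
    by (rule sobolev_derivs_meas[OF d j] sobolev_derivs_meas[OF e j])+
  show "set_borel_measurable lborel {a..b} (\<lambda>t. d j t + e j t)"
    using md me unfolding set_borel_measurable_def by (simp add: scaleR_add_right)
  have "set_integrable lborel {a..b}
      (\<lambda>t. (norm (d j t))\<^sup>2 + (norm (e j t))\<^sup>2 + 2 * (d j t \<bullet> e j t))"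
    by (rule set_integral_add(1)[OF set_integral_add(1)[OF id ie]
          set_integrable_mult_right[OF set_integrable_inner_square[OF md id me ie]]])
  moreover have "(norm (d j t + e j t))\<^sup>2
      = (norm (d j t))\<^sup>2 + (norm (e j t))\<^sup>2 + 2 * (d j t \<bullet> e j t)" for t
    using dot_norm[of "d j t" "e j t"] by simp
  ultimately show "set_integrable lborel {a..b} (\<lambda>t. (norm (d j t + e j t))\<^sup>2)" by simp
next
  fix j t assume j: "j < k" and t: "t \<in> {a..b}"
  have "set_integrable lborel {a..t} (d (Suc j))" "set_integrable lborel {a..t} (e (Suc j))"
    using t j sobolev_derivs_integrable[OF d, of "Suc j"] sobolev_derivs_integrable[OF e, of "Suc j"]
    by (auto intro: set_integrable_subset)
  then have "(LBINT s:{a..t}. d (Suc j) s + e (Suc j) s)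
      = (LBINT s:{a..t}. d (Suc j) s) + (LBINT s:{a..t}. e (Suc j) s)"
    by (rule set_integral_add)
  moreover have "d j t = d j a + (LBINT s:{a..t}. d (Suc j) s)"
    "e j t = e j a + (LBINT s:{a..t}. e (Suc j) s)"
    by (rule sobolev_derivs_ftc[OF d j t] sobolev_derivs_ftc[OF e j t])+
  ultimately show "d j t + e j t = d j a + e j a + (LBINT s:{a..t}. d (Suc j) s + e (Suc j) s)"
    by simp
qed

lemma sobolev_derivs_scaleR:
  fixes f :: "real \<Rightarrow> 'a::euclidean_space"
  assumes d: "sobolev_derivs k a b f d"
  shows "sobolev_derivs k a b (\<lambda>t. r *\<^sub>R f t) (\<lambda>j t. r *\<^sub>R d j t)"
  unfolding sobolev_derivs_def
proof (intro conjI allI impI ballI)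
  fix t assume "t \<in> {a..b}"
  then show "r *\<^sub>R d 0 t = r *\<^sub>R f t" using sobolev_derivs_0[OF d] by simp
next
  fix j assume j: "j \<le> k"
  have md: "set_borel_measurable lborel {a..b} (d j)"
    and id: "set_integrable lborel {a..b} (\<lambda>t. (norm (d j t))\<^sup>2)"
    by (rule sobolev_derivs_meas[OF d j])+
  have "(\<lambda>t. r *\<^sub>R (indicat_real {a..b} t *\<^sub>R d j t)) \<in> borel_measurable lborel"
    using md unfolding set_borel_measurable_def
    by (rule borel_measurable_scaleR[OF borel_measurable_const])
  then show "set_borel_measurable lborel {a..b} (\<lambda>t. r *\<^sub>R d j t)"
    unfolding set_borel_measurable_def by (simp only: scaleR_scaleR mult.commute)
  have "set_integrable lborel {a..b} (\<lambda>t. r\<^sup>2 * (norm (d j t))\<^sup>2)"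
    by (intro set_integrable_mult_right id)
  then show "set_integrable lborel {a..b} (\<lambda>t. (norm (r *\<^sub>R d j t))\<^sup>2)"
    by (simp add: power_mult_distrib)
next
  fix j t assume j: "j < k" and t: "t \<in> {a..b}"
  have "d j t = d j a + (LBINT s:{a..t}. d (Suc j) s)"
    by (rule sobolev_derivs_ftc[OF d j t])
  moreover have "(LBINT s:{a..t}. r *\<^sub>R d (Suc j) s) = r *\<^sub>R (LBINT s:{a..t}. d (Suc j) s)"
    by (rule set_integral_scaleR_right)
  ultimately show "r *\<^sub>R d j t = r *\<^sub>R d j a + (LBINT s:{a..t}. r *\<^sub>R d (Suc j) s)"
    by (simp add: scaleR_add_right)
qed

lemma sobolev_derivs_continuous:
  fixes f :: "real \<Rightarrow> 'a::euclidean_space"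
  assumes d: "sobolev_derivs k a b f d" and j: "j < k"
  shows "continuous_on {a..b} (d j)"
proof -
  have i: "set_integrable lborel {a..b} (d (Suc j))"
    using sobolev_derivs_integrable[OF d] j by simp
  have "d j a + integral {a..t} (d (Suc j)) = d j t" if t: "t \<in> {a..b}" for t
  proof -
    have "set_integrable lborel {a..t} (d (Suc j))"
      by (rule set_integrable_subset[OF i]) (use t in auto)
    then have "(LBINT s:{a..t}. d (Suc j) s) = integral {a..t} (d (Suc j))"
      by (rule set_borel_integral_eq_integral)
    then show ?thesis using sobolev_derivs_ftc[OF d j t] by simp
  qed
  moreover have "continuous_on {a..b} (\<lambda>t. d j a + integral {a..t} (d (Suc j)))"
    by (intro continuous_intros indefinite_integral_continuous_1 set_borel_integral_eq_integral i)
  ultimately show ?thesis by (rule continuous_on_eq[rotated]) 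
qed

lemma continuous_square_integral_zero:
  fixes g :: "real \<Rightarrow> 'a::euclidean_space"
  assumes "a < b" and c: "continuous_on {a..b} g"
    and z: "(LBINT t:{a..b}. (norm (g t))\<^sup>2) = 0" and t: "t \<in> {a..b}"
  shows "g t = 0"
proof -
  have c': "continuous_on {a..b} (\<lambda>t. (norm (g t))\<^sup>2)" by (intro continuous_intros c)
  have "(LBINT t:{a..b}. (norm (g t))\<^sup>2) = integral {a..b} (\<lambda>t. (norm (g t))\<^sup>2)"
    by (rule set_borel_integral_eq_integral(2)[OF borel_integrable_atLeastAtMost'[OF c']])
  then have "\<forall>t\<in>{a..b}. (norm (g t))\<^sup>2 = 0"
    using z integral_eq_0_iff[OF c' \<open>a < b\<close>] by simp
  then have "(norm (g t))\<^sup>2 = 0" using t by (rule bspec)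
  then show ?thesis by simp
qed

lemma AE_zero_if_primitive_zero:
  fixes g :: "real \<Rightarrow> 'a::euclidean_space"
  assumes i: "set_integrable lborel {a..b} g"
    and z: "\<And>t. t \<in> {a..b} \<Longrightarrow> (LBINT s:{a..t}. g s) = 0"
  shows "AE t in lborel. t \<in> {a..b} \<longrightarrow> g t = 0"
proof -
  define f where "f = (\<lambda>t. indicat_real {a..b} t *\<^sub>R g t)"
  have f: "integrable lborel f" using i by (simp add: set_integrable_def f_def)
  have base: "set_lebesgue_integral lborel {..x} f = 0" for x
  proof (cases "a \<le> x \<and> a \<le> b")
    case True
    have "set_lebesgue_integral lborel {..x} f = (LBINT s:{a..min x b}. g s)"
      unfolding set_lebesgue_integral_def f_def
      by (rule Bochner_Integration.integral_cong) (auto simp: indicator_def)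
    also have "\<dots> = 0" using z[of "min x b"] True by auto
    finally show ?thesis .
  next
    case False
    then have "(\<lambda>s. indicat_real {..x} s *\<^sub>R f s) = (\<lambda>s. 0)"
      by (auto simp: f_def indicator_def fun_eq_iff)
    then show ?thesis unfolding set_lebesgue_integral_def by simp
  qed
  have total: "integral\<^sup>L lborel f = 0"
  proof -
    have "integral\<^sup>L lborel f = set_lebesgue_integral lborel {..b} f"
      unfolding set_lebesgue_integral_def f_def
      by (rule Bochner_Integration.integral_cong) (auto simp: indicator_def)
    then show ?thesis using base by simp
  qed
  have "set_lebesgue_integral lborel S f = 0" if "S \<in> sets lborel" for S
  proof -
    have int: "Int_stable (range (\<lambda>x::real. {..x}))"
    proof (rule Int_stableI)
      fix S T :: "real set"
      assume "S \<in> range atMost" "T \<in> range atMost"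
      then obtain x y where "S = {..x}" "T = {..y}" by blast
      then have "S \<inter> T = {..min x y}" by auto
      then show "S \<inter> T \<in> range atMost" by blast
    qed
    have S: "S \<in> sigma_sets UNIV (range (\<lambda>x::real. {..x}))"
      using that by (simp add: borel_eq_atMost)
    have sub: "range (\<lambda>x::real. {..x}) \<subseteq> Pow UNIV" by simp
    have sf: "set_integrable lborel T f" if "T \<in> sets lborel" for T
      unfolding set_integrable_def by (rule integrable_mult_indicator[OF that f])
    have sets: "T \<in> sets lborel" if "T \<in> sigma_sets UNIV (range (\<lambda>x::real. {..x}))" for T
      using that by (simp add: borel_eq_atMost)
    show ?thesis
    proof (rule sigma_sets_induct_disjoint[OF int sub S])
      fix T assume "T \<in> range (\<lambda>x::real. {..x})"
      then show "set_lebesgue_integral lborel T f = 0" using base by auto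
    next
      show "set_lebesgue_integral lborel {} f = 0" by (simp add: set_lebesgue_integral_def)
    next
      fix T assume T: "T \<in> sigma_sets UNIV (range (\<lambda>x::real. {..x}))"
        and 0: "set_lebesgue_integral lborel T f = 0"
      have "set_lebesgue_integral lborel (T \<union> (UNIV - T)) f
          = set_lebesgue_integral lborel T f + set_lebesgue_integral lborel (UNIV - T) f"
        using sets[OF T] by (intro set_integral_Un sf) auto
      moreover have "set_lebesgue_integral lborel (T \<union> (UNIV - T)) f = 0"
        using total by (simp add: set_lebesgue_integral_def)
      ultimately show "set_lebesgue_integral lborel (UNIV - T) f = 0" using 0 by simp
    next
      fix T :: "nat \<Rightarrow> real set"
      assume disj: "disjoint_family T"
        and T: "range T \<subseteq> sigma_sets UNIV (range (\<lambda>x::real. {..x}))"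
        and 0: "\<And>i. set_lebesgue_integral lborel (T i) f = 0"
      have Ts: "T i \<in> sets lborel" for i using T sets by blast
      have "set_lebesgue_integral lborel (\<Union>i. T i) f
          = (\<Sum>i. set_lebesgue_integral lborel (T i) f)"
        using disj Ts by (intro lebesgue_integral_countable_add sf)
          (auto simp: disjoint_family_on_def)
      then show "set_lebesgue_integral lborel (\<Union>i. T i) f = 0" using 0 by simp
    qed
  qed
  then have "AE t in lborel. f t = 0" by (rule sigma_finite_measure.density_zero[OF sigma_finite_lborel f])
  then show ?thesis by (rule AE_mp) (auto simp: f_def)
qed

lemma sobolev_derivs_unique:
  fixes f :: "real \<Rightarrow> 'a::euclidean_space"
  assumes "a < b" and d: "sobolev_derivs k a b f d" and e: "sobolev_derivs k a b f e"
    and "j \<le> k"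
  shows "(AE t in lborel. t \<in> {a..b} \<longrightarrow> d j t = e j t) \<and> (j < k \<longrightarrow> (\<forall>t\<in>{a..b}. d j t = e j t))"
  using \<open>j \<le> k\<close>
proof (induction j)
  case 0
  have "\<forall>t\<in>{a..b}. d 0 t = e 0 t" using sobolev_derivs_0[OF d] sobolev_derivs_0[OF e] by simp
  moreover from this have "AE t in lborel. t \<in> {a..b} \<longrightarrow> d 0 t = e 0 t"
    by (intro AE_I2) blast
  ultimately show ?case by blast
next
  case (Suc j)
  then have j: "j < k" and eq: "\<forall>t\<in>{a..b}. d j t = e j t" by auto
  have i: "set_integrable lborel {a..b} (d (Suc j))" "set_integrable lborel {a..b} (e (Suc j))"
    using sobolev_derivs_integrable[OF d Suc.prems] sobolev_derivs_integrable[OF e Suc.prems] by auto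
  have "AE t in lborel. t \<in> {a..b} \<longrightarrow> d (Suc j) t - e (Suc j) t = 0"
  proof (rule AE_zero_if_primitive_zero)
    show "set_integrable lborel {a..b} (\<lambda>t. d (Suc j) t - e (Suc j) t)"
      by (rule set_integral_diff(1)[OF i])
    fix t assume t: "t \<in> {a..b}"
    have "set_integrable lborel {a..t} (d (Suc j))" "set_integrable lborel {a..t} (e (Suc j))"
      using t i by (auto intro: set_integrable_subset)
    then have "(LBINT s:{a..t}. d (Suc j) s - e (Suc j) s)
        = (LBINT s:{a..t}. d (Suc j) s) - (LBINT s:{a..t}. e (Suc j) s)" (is "?D = ?X - ?Y")
      by (rule set_integral_diff)
    moreover have "?X = ?Y"
    proof -
      have "a \<in> {a..b}" using t by simp
      then have "d j a + ?X = d j a + ?Y"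
        using sobolev_derivs_ftc[OF d j t] sobolev_derivs_ftc[OF e j t] eq t by metis
      then show ?thesis by (rule add_left_imp_eq)
    qed
    ultimately show "?D = 0" by (simp only: diff_self)
  qed
  then have AE: "AE t in lborel. t \<in> {a..b} \<longrightarrow> d (Suc j) t = e (Suc j) t" by simp
  moreover have "\<forall>t\<in>{a..b}. d (Suc j) t = e (Suc j) t" if "Suc j < k"
  proof
    fix t assume t: "t \<in> {a..b}"
    have "d (Suc j) t - e (Suc j) t = 0"
    proof (rule continuous_square_integral_zero[OF \<open>a < b\<close> _ _ t])
      show "continuous_on {a..b} (\<lambda>t. d (Suc j) t - e (Suc j) t)"
        by (intro continuous_intros sobolev_derivs_continuous[OF d that]
            sobolev_derivs_continuous[OF e that])
      show "(LBINT t:{a..b}. (norm (d (Suc j) t - e (Suc j) t))\<^sup>2) = 0"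
        unfolding set_lebesgue_integral_def
        by (rule integral_eq_zero_AE) (use AE in \<open>auto simp: indicator_def\<close>)
    qed
    then show "d (Suc j) t = e (Suc j) t" by simp
  qed
  ultimately show ?case by blast
qed

lemma weak_deriv:
  assumes "sobolev_circle k f"
  shows "sobolev_derivs k 0 (2 * pi) (f \<circ> circle_exp) (weak_deriv k f)"
proof -
  have "\<exists>d. sobolev_derivs k 0 (2 * pi) (f \<circ> circle_exp) d"
    using assms pi_gt_zero by (auto simp: sobolev_circle_def sobolev_on_def)
  then show ?thesis unfolding weak_deriv_def by (rule someI_ex)
qed

lemma sobolev_circle_add:
  assumes f: "sobolev_circle k f" and g: "sobolev_circle k g"
  shows "sobolev_circle k (\<lambda>s. f s + g s)"
  unfolding sobolev_circle_def
proof (intro allI impI)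
  fix a b :: real assume "a < b"
  then obtain d e where "sobolev_derivs k a b (f \<circ> circle_exp) d"
    "sobolev_derivs k a b (g \<circ> circle_exp) e"
    using f g unfolding sobolev_circle_def sobolev_on_def by blast
  from sobolev_derivs_add[OF this]
  have "sobolev_on k a b (\<lambda>t. (f \<circ> circle_exp) t + (g \<circ> circle_exp) t)"
    unfolding sobolev_on_def by blast
  then show "sobolev_on k a b ((\<lambda>s. f s + g s) \<circ> circle_exp)" by (simp only: comp_def)
qed

lemma sobolev_circle_scaleR:
  assumes f: "sobolev_circle k f"
  shows "sobolev_circle k (\<lambda>s. r *\<^sub>R f s)"
  unfolding sobolev_circle_def
proof (intro allI impI)
  fix a b :: real assume "a < b"
  then obtain d where "sobolev_derivs k a b (f \<circ> circle_exp) d"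
    using f unfolding sobolev_circle_def sobolev_on_def by blast
  from sobolev_derivs_scaleR[OF this, of r]
  have "sobolev_on k a b (\<lambda>t. r *\<^sub>R (f \<circ> circle_exp) t)"
    unfolding sobolev_on_def by blast
  then show "sobolev_on k a b ((\<lambda>s. r *\<^sub>R f s) \<circ> circle_exp)" by (simp only: comp_def)
qed

lemma sobolev_circle_zero: "sobolev_circle k (\<lambda>s. 0 :: 'a::euclidean_space)"
proof -
  have "sobolev_derivs k a b ((\<lambda>s. 0 :: 'a) \<circ> circle_exp) (\<lambda>j t. 0)" for a b
    by (auto simp: sobolev_derivs_def set_borel_measurable_def set_integrable_def)
  then show ?thesis by (auto simp: sobolev_circle_def sobolev_on_def)
qed

lemma weak_deriv_add_AE:
  assumes f: "sobolev_circle k f" and g: "sobolev_circle k g" and j: "j \<le> k"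
  shows "AE t in lborel. t \<in> {0..2 * pi} \<longrightarrow>
    weak_deriv k (\<lambda>s. f s + g s) j t = weak_deriv k f j t + weak_deriv k g j t"
proof -
  have "sobolev_derivs k 0 (2 * pi) ((\<lambda>s. f s + g s) \<circ> circle_exp)
      (\<lambda>j t. weak_deriv k f j t + weak_deriv k g j t)"
    using sobolev_derivs_add[OF weak_deriv[OF f] weak_deriv[OF g]] by (simp add: comp_def)
  from sobolev_derivs_unique[OF _ weak_deriv[OF sobolev_circle_add[OF f g]] this j]
  show ?thesis using pi_gt_zero by simp
qed

lemma weak_deriv_scaleR_AE:
  assumes f: "sobolev_circle k f" and j: "j \<le> k"
  shows "AE t in lborel. t \<in> {0..2 * pi} \<longrightarrow>
    weak_deriv k (\<lambda>s. r *\<^sub>R f s) j t = r *\<^sub>R weak_deriv k f j t"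
proof -
  have "sobolev_derivs k 0 (2 * pi) ((\<lambda>s. r *\<^sub>R f s) \<circ> circle_exp)
      (\<lambda>j t. r *\<^sub>R weak_deriv k f j t)"
    using sobolev_derivs_scaleR[OF weak_deriv[OF f]] by (simp add: comp_def)
  from sobolev_derivs_unique[OF _ weak_deriv[OF sobolev_circle_scaleR[OF f]] this j]
  show ?thesis using pi_gt_zero by simp
qed

lemma weak_deriv_inner_integrable:
  assumes "sobolev_circle k f" "sobolev_circle k g" "j \<le> k"
  shows "set_integrable lborel {0..2 * pi} (\<lambda>t. weak_deriv k f j t \<bullet> weak_deriv k g j t)"
  using sobolev_derivs_meas[OF weak_deriv[OF assms(1)] assms(3)]
    sobolev_derivs_meas[OF weak_deriv[OF assms(2)] assms(3)]
  by (intro set_integrable_inner_square)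

lemma sobolev_inner_commute: "sobolev_inner k f g = sobolev_inner k g f"
  by (simp add: sobolev_inner_def inner_commute)

lemma sobolev_inner_add_left:
  assumes f: "sobolev_circle k f" and g: "sobolev_circle k g" and h: "sobolev_circle k h"
  shows "sobolev_inner k (\<lambda>s. f s + g s) h = sobolev_inner k f h + sobolev_inner k g h"
proof -
  have "(LBINT t:{0..2 * pi}. weak_deriv k (\<lambda>s. f s + g s) j t \<bullet> weak_deriv k h j t)
      = (LBINT t:{0..2 * pi}. weak_deriv k f j t \<bullet> weak_deriv k h j t)
      + (LBINT t:{0..2 * pi}. weak_deriv k g j t \<bullet> weak_deriv k h j t)" if j: "j \<le> k" for j
  proof -
    note ifh = weak_deriv_inner_integrable[OF f h j] and igh = weak_deriv_inner_integrable[OF g h j]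
      and ifgh = weak_deriv_inner_integrable[OF sobolev_circle_add[OF f g] h j]
    have "(LBINT t:{0..2 * pi}. weak_deriv k (\<lambda>s. f s + g s) j t \<bullet> weak_deriv k h j t)
        = (LBINT t:{0..2 * pi}. weak_deriv k f j t \<bullet> weak_deriv k h j t
              + weak_deriv k g j t \<bullet> weak_deriv k h j t)"
      unfolding set_lebesgue_integral_def
    proof (rule integral_cong_AE)
      show "(\<lambda>t. indicat_real {0..2 * pi} t *\<^sub>R
          (weak_deriv k (\<lambda>s. f s + g s) j t \<bullet> weak_deriv k h j t)) \<in> borel_measurable lborel"
        using ifgh unfolding set_integrable_def by (rule borel_measurable_integrable)
      show "(\<lambda>t. indicat_real {0..2 * pi} t *\<^sub>R (weak_deriv k f j t \<bullet> weak_deriv k h j t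
              + weak_deriv k g j t \<bullet> weak_deriv k h j t)) \<in> borel_measurable lborel"
        using set_integral_add(1)[OF ifh igh] unfolding set_integrable_def
        by (rule borel_measurable_integrable)
      show "AE t in lborel. indicat_real {0..2 * pi} t *\<^sub>R
            (weak_deriv k (\<lambda>s. f s + g s) j t \<bullet> weak_deriv k h j t)
          = indicat_real {0..2 * pi} t *\<^sub>R (weak_deriv k f j t \<bullet> weak_deriv k h j t
              + weak_deriv k g j t \<bullet> weak_deriv k h j t)"
        using weak_deriv_add_AE[OF f g j]
        by eventually_elim (auto simp: indicator_def inner_add_left)
    qed
    then show ?thesis using set_integral_add(2)[OF ifh igh] by simp
  qed
  then show ?thesis unfolding sobolev_inner_def by (simp add: sum.distrib)
qed

lemma sobolev_inner_scaleR_left: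
  assumes f: "sobolev_circle k f" and h: "sobolev_circle k h"
  shows "sobolev_inner k (\<lambda>s. r *\<^sub>R f s) h = r * sobolev_inner k f h"
proof -
  have "(LBINT t:{0..2 * pi}. weak_deriv k (\<lambda>s. r *\<^sub>R f s) j t \<bullet> weak_deriv k h j t)
      = r * (LBINT t:{0..2 * pi}. weak_deriv k f j t \<bullet> weak_deriv k h j t)" if j: "j \<le> k" for j
  proof -
    note ifh = weak_deriv_inner_integrable[OF f h j]
      and irfh = weak_deriv_inner_integrable[OF sobolev_circle_scaleR[OF f] h j]
    have "(LBINT t:{0..2 * pi}. weak_deriv k (\<lambda>s. r *\<^sub>R f s) j t \<bullet> weak_deriv k h j t)
        = (LBINT t:{0..2 * pi}. r * (weak_deriv k f j t \<bullet> weak_deriv k h j t))"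
      unfolding set_lebesgue_integral_def
    proof (rule integral_cong_AE)
      show "(\<lambda>t. indicat_real {0..2 * pi} t *\<^sub>R
          (weak_deriv k (\<lambda>s. r *\<^sub>R f s) j t \<bullet> weak_deriv k h j t)) \<in> borel_measurable lborel"
        using irfh unfolding set_integrable_def by (rule borel_measurable_integrable)
      show "(\<lambda>t. indicat_real {0..2 * pi} t *\<^sub>R (r * (weak_deriv k f j t \<bullet> weak_deriv k h j t)))
          \<in> borel_measurable lborel"
        using set_integrable_mult_right[OF ifh] unfolding set_integrable_def
        by (rule borel_measurable_integrable)
      show "AE t in lborel. indicat_real {0..2 * pi} t *\<^sub>R
            (weak_deriv k (\<lambda>s. r *\<^sub>R f s) j t \<bullet> weak_deriv k h j t)
          = indicat_real {0..2 * pi} t *\<^sub>R (r * (weak_deriv k f j t \<bullet> weak_deriv k h j t))"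
        using weak_deriv_scaleR_AE[OF f j, of r] by eventually_elim (auto simp: indicator_def)
    qed
    then show ?thesis by simp
  qed
  then show ?thesis unfolding sobolev_inner_def by (simp add: sum_distrib_left)
qed

lemma sobolev_inner_nonneg: "0 \<le> sobolev_inner k f f"
  unfolding sobolev_inner_def set_lebesgue_integral_def
  by (intro sum_nonneg Bochner_Integration.integral_nonneg) auto

lemma circle_exp_surj: "\<exists>t\<in>{0..2 * pi}. s = circle_exp t"
proof -
  have "norm (Rep_circle s) = 1" using Rep_circle[of s] by simp
  then have "Rep_circle s = cis (Arg2pi (Rep_circle s))"
    using Arg2pi_eq[of "Rep_circle s"] by (simp add: cis_conv_exp)
  then have "s = circle_exp (Arg2pi (Rep_circle s))"
    unfolding circle_exp_def by (metis Rep_circle_inverse)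
  moreover have "Arg2pi (Rep_circle s) \<in> {0..2 * pi}"
    using Arg2pi_ge_0 Arg2pi_lt_2pi by (simp add: less_imp_le)
  ultimately show ?thesis by blast
qed

lemma sobolev_inner_zero_iff:
  assumes f: "sobolev_circle k f" and k: "0 < k"
  shows "sobolev_inner k f f = 0 \<longleftrightarrow> f = (\<lambda>s. 0)"
proof
  assume z: "sobolev_inner k f f = 0"
  have "0 \<le> (LBINT t:{0..2 * pi}. weak_deriv k f j t \<bullet> weak_deriv k f j t)" for j
    unfolding set_lebesgue_integral_def by (intro Bochner_Integration.integral_nonneg) auto
  then have "(LBINT t:{0..2 * pi}. weak_deriv k f 0 t \<bullet> weak_deriv k f 0 t) = 0"
    using z unfolding sobolev_inner_def by (subst (asm) sum_nonneg_eq_0_iff) auto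
  then have z0: "(LBINT t:{0..2 * pi}. (norm (weak_deriv k f 0 t))\<^sup>2) = 0"
    by (simp add: power2_norm_eq_inner)
  have pos: "0 < 2 * pi" by simp
  have d0: "weak_deriv k f 0 t = 0" if "t \<in> {0..2 * pi}" for t
    by (rule continuous_square_integral_zero[OF pos
          sobolev_derivs_continuous[OF weak_deriv[OF f] k] z0 that])
  have 0: "f (circle_exp t) = 0" if "t \<in> {0..2 * pi}" for t
    using sobolev_derivs_0[OF weak_deriv[OF f] that] d0[OF that] by simp
  show "f = (\<lambda>s. 0)"
  proof
    fix s
    obtain t where "t \<in> {0..2 * pi}" "s = circle_exp t" using circle_exp_surj by blast
    then show "f s = 0" using 0 by simp
  qed
next
  assume "f = (\<lambda>s. 0)"
  then show "sobolev_inner k f f = 0"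
    using sobolev_inner_scaleR_left[OF f f, of 0] by simp
qed

text \<open>\<open>('k, 'a) sobolev_loop\<close> is the space of \<open>W\<^sup>k\<^sup>,\<^sup>2\<close> maps from the circle to \<open>'a\<close>, where the order
  is \<open>k = CARD('k)\<close>, an arbitrary integer \<open>\<ge> 1\<close>. Its elements are genuine (continuous) functions.\<close>

typedef (overloaded) ('k, 'a) sobolev_loop =
  "{f :: circle \<Rightarrow> 'a::euclidean_space. sobolev_circle CARD('k::finite) f}"
  morphisms loop_fun Sobolev_loop
  by (rule exI[of _ "\<lambda>s. 0"]) (simp add: sobolev_circle_zero)

setup_lifting type_definition_sobolev_loop

instantiation sobolev_loop :: (finite, euclidean_space) real_inner
begin

lift_definition zero_sobolev_loop :: "('a, 'b) sobolev_loop" is "\<lambda>s. 0"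
  by (rule sobolev_circle_zero)

lift_definition plus_sobolev_loop ::
    "('a, 'b) sobolev_loop \<Rightarrow> ('a, 'b) sobolev_loop \<Rightarrow> ('a, 'b) sobolev_loop"
  is "\<lambda>f g s. f s + g s"
  by (rule sobolev_circle_add)

lift_definition scaleR_sobolev_loop ::
    "real \<Rightarrow> ('a, 'b) sobolev_loop \<Rightarrow> ('a, 'b) sobolev_loop"
  is "\<lambda>r f s. r *\<^sub>R f s"
  by (rule sobolev_circle_scaleR)

lift_definition uminus_sobolev_loop :: "('a, 'b) sobolev_loop \<Rightarrow> ('a, 'b) sobolev_loop"
  is "\<lambda>f s. - f s"
  using sobolev_circle_scaleR[of _ _ "-1"] by fastforce

lift_definition minus_sobolev_loop ::
    "('a, 'b) sobolev_loop \<Rightarrow> ('a, 'b) sobolev_loop \<Rightarrow> ('a, 'b) sobolev_loop"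
  is "\<lambda>f g s. f s - g s"
  using sobolev_circle_add[OF _ sobolev_circle_scaleR[of _ _ "-1"]] by fastforce

lift_definition inner_sobolev_loop ::
    "('a, 'b) sobolev_loop \<Rightarrow> ('a, 'b) sobolev_loop \<Rightarrow> real"
  is "sobolev_inner CARD('a)" .

definition norm_sobolev_loop :: "('a, 'b) sobolev_loop \<Rightarrow> real" where
  "norm_sobolev_loop f = sqrt (inner f f)"

definition dist_sobolev_loop :: "('a, 'b) sobolev_loop \<Rightarrow> ('a, 'b) sobolev_loop \<Rightarrow> real" where
  "dist_sobolev_loop f g = norm (f - g)"

definition sgn_sobolev_loop :: "('a, 'b) sobolev_loop \<Rightarrow> ('a, 'b) sobolev_loop" where
  "sgn_sobolev_loop f = inverse (norm f) *\<^sub>R f"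

definition uniformity_sobolev_loop ::
    "(('a, 'b) sobolev_loop \<times> ('a, 'b) sobolev_loop) filter" where
  "uniformity_sobolev_loop = (INF e\<in>{0<..}. principal {(f, g). dist f g < e})"

definition open_sobolev_loop :: "('a, 'b) sobolev_loop set \<Rightarrow> bool" where
  "open_sobolev_loop U \<longleftrightarrow> (\<forall>f\<in>U. eventually (\<lambda>(f', g). f' = f \<longrightarrow> g \<in> U) uniformity)"

instance
proof
  fix f g h :: "('a, 'b) sobolev_loop" and r q :: real and U :: "('a, 'b) sobolev_loop set"
  show "f + g + h = f + (g + h)" "f + g = g + f" "0 + f = f" "- f + f = 0" "f - g = f + - g"
    by (transfer; simp add: fun_eq_iff algebra_simps)+
  show "r *\<^sub>R (f + g) = r *\<^sub>R f + r *\<^sub>R g" "(r + q) *\<^sub>R f = r *\<^sub>R f + q *\<^sub>R f"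
    "r *\<^sub>R q *\<^sub>R f = (r * q) *\<^sub>R f" "1 *\<^sub>R f = f"
    by (transfer; simp add: fun_eq_iff algebra_simps)+
  show "inner f g = inner g f" by transfer (rule sobolev_inner_commute)
  show "inner (f + g) h = inner f h + inner g h" by transfer (rule sobolev_inner_add_left)
  show "inner (r *\<^sub>R f) g = r * inner f g" by transfer (rule sobolev_inner_scaleR_left)
  show "0 \<le> inner f f" by transfer (rule sobolev_inner_nonneg)
  show "inner f f = 0 \<longleftrightarrow> f = 0" by transfer (simp add: sobolev_inner_zero_iff)
  show "norm f = sqrt (inner f f)" by (rule norm_sobolev_loop_def)
  show "dist f g = norm (f - g)" by (rule dist_sobolev_loop_def)
  show "sgn f = inverse (norm f) *\<^sub>R f" by (rule sgn_sobolev_loop_def)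
  show "uniformity = (INF e\<in>{0<..}. principal {(f, g::('a, 'b) sobolev_loop). dist f g < e})"
    by (rule uniformity_sobolev_loop_def)
  show "open U \<longleftrightarrow> (\<forall>f\<in>U. eventually (\<lambda>(f', g). f' = f \<longrightarrow> g \<in> U) uniformity)"
    by (rule open_sobolev_loop_def)
qed

end


section \<open>The Sobolev loop space of a complex manifold\<close>

definition loop_space :: "nat \<Rightarrow> ('x::topological_space, 'n::finite) chart set \<Rightarrow> (circle \<Rightarrow> 'x) set" where
  "loop_space k A =
     {g. continuous_on UNIV g \<and>
         (\<forall>c\<in>A. \<forall>a b. a < b \<and> g ` circle_exp ` {a..b} \<subseteq> fst c \<longrightarrow>
            sobolev_on k a b (\<lambda>t. snd c (g (circle_exp t))))}"

text \<open>The complex Hilbert manifold structure of the loop space. Let \<open>U\<close> be open in the product of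
  the circle with \<open>\<complex>\<^sup>n\<close>, and let \<open>\<Phi> : U \<rightarrow> X\<close> be smooth and, for every fixed \<open>s\<close>, injective and
  holomorphic (hence biholomorphic onto an open set) on the slice \<open>{z. (s, z) \<in> U}\<close>. For
  \<open>u\<close> in \<open>W\<^sup>k\<^sup>,\<^sup>2\<close> with graph in \<open>U\<close> the loop \<open>s \<mapsto> \<Phi> (s, u s)\<close> lies in the loop space, and the maps
  \<open>u \<mapsto> (s \<mapsto> \<Phi> (s, u s))\<close> are the inverses of the charts of the loop space: every loop is in
  the range of such a map, because a neighbourhood of its graph is a fibrewise biholomorphic image
  of a neighbourhood of the zero section of a complex vector bundle over the circle, and every
  such bundle is trivial.\<close>

definition loop_chart ::
    "('x::topological_space, 'n::finite) chart set \<Rightarrow> (circle \<times> (complex^'n)) set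
       \<Rightarrow> (circle \<times> (complex^'n) \<Rightarrow> 'x) \<Rightarrow> bool" where
  "loop_chart A U \<Phi> \<longleftrightarrow>
     open U \<and> continuous_on U \<Phi> \<and>
     (\<forall>c\<in>A. smooth_on {(\<theta>, z). (circle_exp \<theta>, z) \<in> U \<and> \<Phi> (circle_exp \<theta>, z) \<in> fst c}
        (\<lambda>(\<theta>, z). snd c (\<Phi> (circle_exp \<theta>, z)))) \<and>
     (\<forall>s. inj_on (\<lambda>z. \<Phi> (s, z)) {z. (s, z) \<in> U}) \<and>
     (\<forall>s. \<forall>c\<in>A. holomorphic_map_on {z. (s, z) \<in> U \<and> \<Phi> (s, z) \<in> fst c}
        (\<lambda>z. snd c (\<Phi> (s, z))))"

definition loop_param ::
    "(circle \<times> (complex^'n) \<Rightarrow> 'x) \<Rightarrow> ('k::finite, complex^'n::finite) sobolev_loop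
       \<Rightarrow> circle \<Rightarrow> 'x" where
  "loop_param \<Phi> u = (\<lambda>s. \<Phi> (s, loop_fun u s))"

definition loop_chart_range ::
    "('x::topological_space, 'n::finite) chart set \<Rightarrow> (circle \<times> (complex^'n)) set
       \<Rightarrow> (circle \<times> (complex^'n) \<Rightarrow> 'x) \<Rightarrow> ('k::finite, complex^'n) sobolev_loop set" where
  "loop_chart_range A U \<Phi> =
     {u. (\<forall>s. (s, loop_fun u s) \<in> U) \<and> loop_param \<Phi> u \<in> loop_space CARD('k) A}"

text \<open>The derivative of \<open>loop_param \<Phi>\<close> at \<open>u\<close>: it identifies the model space \<open>W\<^sup>k\<^sup>,\<^sup>2\<close> with the
  space of \<open>W\<^sup>k\<^sup>,\<^sup>2\<close> sections of the pull-back of the tangent bundle along \<open>g = loop_param \<Phi> u\<close>,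
  i.e. with the tangent space of the loop space at \<open>g\<close>. Such a section is a function \<open>\<xi>\<close>
  with \<open>\<xi> s\<close> a tangent vector at \<open>g s\<close>.\<close>

definition loop_param_deriv ::
    "('x, 'n::finite) chart set \<Rightarrow> (circle \<times> (complex^'n) \<Rightarrow> 'x)
       \<Rightarrow> ('k::finite, complex^'n) sobolev_loop \<Rightarrow> ('k, complex^'n) sobolev_loop
       \<Rightarrow> circle \<Rightarrow> ('x, 'n) tvec" where
  "loop_param_deriv A \<Phi> u a =
     (\<lambda>s c. if c \<in> A \<and> \<Phi> (s, loop_fun u s) \<in> fst c
            then frechet_derivative (\<lambda>z. snd c (\<Phi> (s, z))) (at (loop_fun u s)) (loop_fun a s)
            else 0)"

definition loop_metric ::
    "circle measure \<Rightarrow> ('x \<Rightarrow> ('x, 'n) tvec \<Rightarrow> ('x, 'n) tvec \<Rightarrow> complex)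
       \<Rightarrow> (circle \<Rightarrow> 'x) \<Rightarrow> (circle \<Rightarrow> ('x, 'n) tvec) \<Rightarrow> (circle \<Rightarrow> ('x, 'n) tvec) \<Rightarrow> complex" where
  "loop_metric \<mu> h g \<xi> \<eta> = (LINT s|\<mu>. h (g s) (\<xi> s) (\<eta> s))"

definition closed_loop_2form ::
    "'k::finite itself \<Rightarrow> ('x::topological_space, 'n::finite) chart set
       \<Rightarrow> ((circle \<Rightarrow> 'x) \<Rightarrow> (circle \<Rightarrow> ('x, 'n) tvec) \<Rightarrow> (circle \<Rightarrow> ('x, 'n) tvec) \<Rightarrow> real) \<Rightarrow> bool" where
  "closed_loop_2form TYPE('k) A \<Omega> \<longleftrightarrow>
     (\<forall>U \<Phi>. loop_chart A U \<Phi> \<longrightarrow>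
        closed_2form_on (loop_chart_range A U \<Phi> :: ('k, complex^'n) sobolev_loop set)
          (\<lambda>u a b. \<Omega> (loop_param \<Phi> u) (loop_param_deriv A \<Phi> u a) (loop_param_deriv A \<Phi> u b)))"

definition loop_kaehler ::
    "'k::finite itself \<Rightarrow> ('x::topological_space, 'n::finite) chart set
       \<Rightarrow> ((circle \<Rightarrow> 'x) \<Rightarrow> (circle \<Rightarrow> ('x, 'n) tvec) \<Rightarrow> (circle \<Rightarrow> ('x, 'n) tvec) \<Rightarrow> complex) \<Rightarrow> bool" where
  "loop_kaehler TYPE('k) A H \<longleftrightarrow> closed_loop_2form TYPE('k) A (fundamental_form H)"

end

theory Submission
  imports Defs
begin

text \<open>In a chart given by \<open>\<Phi>\<close>, the form \<open>\<Omega>\<close> at a loop \<open>u\<close> is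
  \<open>(a, b) \<mapsto> \<integral> \<beta>\<^sub>s (u s) (a s) (b s) ds\<close>, where \<open>\<beta>\<^sub>s\<close> is the pull-back of \<open>\<omega>\<close> along
  \<open>\<Phi> (s, _)\<close>. Each \<open>\<beta>\<^sub>s\<close> is a closed two-form on an open subset of \<open>\<complex>\<^sup>n\<close>, because pulling back
  commutes with \<open>d\<close>. As \<open>\<beta>\<close> and its derivative in the fibre direction are jointly continuous, the
  circle is compact and \<open>W\<^sup>k\<^sup>,\<^sup>2\<close> embeds into the continuous loops, one may differentiate under
  the integral sign, so that \<open>(d\<Omega>)\<^sub>u (a, b, c) = \<integral> (d\<beta>\<^sub>s) (u s) (a s, b s, c s) ds = 0\<close>.\<close>

section \<open>Bounded bilinear forms and differentiation under the integral\<close>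

text \<open>The target notion asks for a Frechet derivative in operator norm of a map into bounded
  bilinear forms on the loop space, so pointwise convergence of integrands is too weak: the
  remainder must be small uniformly in \<open>s\<close>, relative to the sup norm of the increment.
  A tube around the graph of \<open>u\<close> gives this once the fibre derivative of the
  pulled-back form is jointly continuous. Two obstacles shape the way there. The Kaehler condition
  on X only says that the coordinate form is differentiable; continuity of its derivative comes from
  the smoothness of \<open>h\<close>. And the circle is a bare metric space, with smoothness of
  \<open>\<Phi>\<close> expressed through \<open>circle_exp\<close>; derivatives of
  \<open>\<Phi>\<close> are therefore taken over \<open>real \<times> complex^'n\<close>, with the
  angle as a parameter and only vectors \<open>(0, a)\<close> inserted, and continuity is carried
  back to the circle by local inverses of \<open>circle_exp\<close>. Vectors tangent to X are
  families over all charts, so computations with them are moved to a single chart by the chain rule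
  for transition maps.\<close>

lemma differentiable_blinfun_componentwise:
  fixes f :: "'a::real_normed_vector \<Rightarrow> 'b::euclidean_space \<Rightarrow>\<^sub>L 'c::real_normed_vector"
  assumes "\<And>i. i \<in> Basis \<Longrightarrow> (\<lambda>x. f x i) differentiable (at x)"
  shows "f differentiable (at x)"
proof -
  \<comment> \<open>On a finite-dimensional domain an operator is the sum of its values on the
    basis, each composed with a coordinate functional; the passage from values to operator is
    bounded linear.\<close>
  have eq: "f = (\<lambda>x. \<Sum>i\<in>Basis. blinfun_scaleR_left (f x i) o\<^sub>L blinfun_inner_left i)"
    by (intro ext blinfun_euclidean_eqI)
      (simp add: blinfun.sum_left blinfun_inner_left.rep_eq inner_Basis if_distrib[of "\<lambda>r. r *\<^sub>R _"] cong: if_cong)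
  have "bounded_linear (\<lambda>y. blinfun_scaleR_left y o\<^sub>L blinfun_inner_left i)" for i :: 'b
    by (rule bounded_linear_compose[OF bounded_bilinear.bounded_linear_left[OF bounded_bilinear_blinfun_compose]
          bounded_linear_blinfun_scaleR_left])
  then show ?thesis
    by (subst eq) (intro differentiable_sum finite_Basis ballI
        differentiable_chain_at[unfolded comp_def, OF assms] bounded_linear_imp_differentiable)
qed

lemma continuous_on_blinfun_componentwise:
  fixes f :: "'a::topological_space \<Rightarrow> 'b::euclidean_space \<Rightarrow>\<^sub>L 'c::real_normed_vector"
  assumes "\<And>i. i \<in> Basis \<Longrightarrow> continuous_on S (\<lambda>x. f x i)"
  shows "continuous_on S f"
  using assms unfolding continuous_on_def by (auto intro: tendsto_componentwise1)

text \<open>\<open>Blinfun\<close> is unspecified off bounded linear maps, so the term can be formed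
  before boundedness is known; every use goes through \<open>bilin_apply\<close>, which asks for
  \<open>bounded_bilinear\<close>.\<close>

definition bilin :: "('a::real_normed_vector \<Rightarrow> 'b::real_normed_vector \<Rightarrow> 'c::real_normed_vector)
    \<Rightarrow> 'a \<Rightarrow>\<^sub>L 'b \<Rightarrow>\<^sub>L 'c" where
  "bilin f = Blinfun (\<lambda>a. Blinfun (f a))"

lemma bilin_apply:
  assumes "bounded_bilinear f"
  shows "blinfun_apply (blinfun_apply (bilin f) a) b = f a b"
proof -
  interpret bounded_bilinear f by fact
  have eq: "(\<lambda>a. Blinfun (f a)) = prod_right"
    by (intro ext) (simp add: prod_right_def)
  have "blinfun_apply (bilin f) a = Blinfun (f a)"
    unfolding bilin_def by (subst bounded_linear_Blinfun_apply) (auto simp: eq bounded_linear_prod_right)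
  then show ?thesis by (simp add: bounded_linear_Blinfun_apply bounded_linear_right)
qed

lemma norm_blinfun2_bound:
  fixes B :: "'a::real_normed_vector \<Rightarrow>\<^sub>L 'b::real_normed_vector \<Rightarrow>\<^sub>L 'c::real_normed_vector"
  assumes "0 \<le> m" "\<And>a b. norm (B a b) \<le> m * norm a * norm b"
  shows "norm B \<le> m"
proof (rule norm_blinfun_bound[OF assms(1)])
  show "norm (B a) \<le> m * norm a" for a
    by (rule norm_blinfun_bound) (use assms in auto)
qed

lemma norm_blinfun2:
  fixes B :: "'a::real_normed_vector \<Rightarrow>\<^sub>L 'b::real_normed_vector \<Rightarrow>\<^sub>L 'c::real_normed_vector"
  shows "norm (B a b) \<le> norm B * norm a * norm b"
  by (rule order_trans[OF norm_blinfun]) (simp add: mult_right_mono norm_blinfun)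

text \<open>Compactness makes the radius \<open>d\<close> independent of \<open>s\<close>: the pairs
  \<open>(w, s)\<close> at which \<open>f'\<close> differs by less than \<open>e\<close> from its
  value on the graph form an open set around \<open>{0} \<times> UNIV\<close>, so the tube lemma
  provides a ball of increments valid for all \<open>s\<close>. On that ball the mean value
  inequality bounds the linearization error.\<close>

lemma uniform_linearization:
  fixes f :: "'s::metric_space \<times> 'a::real_normed_vector \<Rightarrow> 'b::real_normed_vector"
    and f' :: "'s \<times> 'a \<Rightarrow> 'a \<Rightarrow>\<^sub>L 'b"
  assumes comp: "compact (UNIV :: 's set)" and U: "open U"
    and deriv: "\<And>s z. (s, z) \<in> U \<Longrightarrow> ((\<lambda>z. f (s, z)) has_derivative f' (s, z)) (at z)"
    and cont: "continuous_on U f'" and u: "continuous_on UNIV u"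
    and graph: "\<And>s. (s, u s) \<in> U" and e: "e > 0"
  obtains d where "d > 0"
    "\<And>s w. norm w < d \<Longrightarrow> (s, u s + w) \<in> U"
    "\<And>s w. norm w < d \<Longrightarrow> norm (f (s, u s + w) - f (s, u s) - f' (s, u s) w) \<le> e * norm w"
proof -
  \<comment> \<open>Coordinates centred on the graph, with the increment in the first place as the
    tube lemma expects.\<close>
  define g where "g = (\<lambda>(w, s). (s, u s + w))"
  define V where "V = g -` U"
  have u': "continuous_on S (\<lambda>x. u (k x))" if "continuous_on S k" for S :: "('a \<times> 's) set" and k
    by (rule continuous_on_compose2[OF u that]) auto
  have g: "continuous_on S g" for S
    unfolding g_def split_def by (intro continuous_intros u')
  have V: "open V" unfolding V_def using open_vimage[OF U g] .
  define W where "W = V \<inter> (\<lambda>p. norm (f' (g p) - f' (g (0, snd p)))) -` {..<e}"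
  have openW: "open W" unfolding W_def
  proof (rule continuous_open_preimage[OF _ V])
    show "continuous_on V (\<lambda>p. norm (f' (g p) - f' (g (0, snd p))))"
    proof (intro continuous_intros)
      show "continuous_on V (\<lambda>p. f' (g p))"
        by (rule continuous_on_compose2[OF cont g]) (auto simp: V_def)
      have "continuous_on V (\<lambda>p. g (0, snd p))"
        by (rule continuous_on_compose2[OF g[of UNIV]]) (auto intro!: continuous_intros)
      then show "continuous_on V (\<lambda>p. f' (g (0, snd p)))"
        by (rule continuous_on_compose2[OF cont]) (auto simp: g_def graph)
    qed
  qed auto
  have "{0} \<times> UNIV \<subseteq> W" using e by (auto simp: W_def V_def g_def graph)
  from Elementary_Topology.tube_lemma[OF comp openW this]
  obtain X where X: "0 \<in> X" "open X" "X \<times> UNIV \<subseteq> W" by (elim exE conjE)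
  then obtain d where d: "d > 0" "ball 0 d \<subseteq> X" using open_contains_ball_eq by metis
  have inW: "(w, s) \<in> W" if "norm w < d" for w s
    using X d that by (auto simp: subset_iff)
  show thesis
  proof
    show "d > 0" by fact
    show inU: "(s, u s + w) \<in> U" if "norm w < d" for s w
      using inW[OF that, of s] by (simp add: W_def V_def g_def)
    show "norm (f (s, u s + w) - f (s, u s) - f' (s, u s) w) \<le> e * norm w" if w: "norm w < d" for s w
    proof -
      have "norm (f (s, u s + w) - f (s, u s) - f' (s, u s) (u s + w - u s)) \<le> norm (u s + w - u s) * e"
      proof (rule differentiable_bound_linearization[where f = "\<lambda>z. f (s, z)" and S = "ball (u s) d"
            and f' = "\<lambda>z. blinfun_apply (f' (s, z))"])
        fix t :: real assume t: "t \<in> {0..1}"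
        then have "t * norm w \<le> 1 * norm w" by (intro mult_right_mono) auto
        then show "u s + t *\<^sub>R (u s + w - u s) \<in> ball (u s) d"
          using w t by (simp add: dist_norm)
      next
        fix x assume "x \<in> ball (u s) d"
        then have x: "norm (x - u s) < d" by (simp add: dist_norm norm_minus_commute)
        have "(s, x) \<in> U" using inU[OF x, of s] by simp
        then show "((\<lambda>z. f (s, z)) has_derivative f' (s, x)) (at x within ball (u s) d)"
          by (rule has_derivative_at_withinI[OF deriv])
        have "norm (f' (s, x) - f' (s, u s)) < e"
          using inW[OF x, of s] by (simp add: W_def g_def)
        then show "onorm (blinfun_apply (f' (s, x)) - blinfun_apply (f' (s, u s))) \<le> e"
          by (simp add: norm_blinfun.rep_eq minus_blinfun.rep_eq fun_diff_def)
      next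
        show "u s \<in> ball (u s) d" using d by simp
      qed
      then show ?thesis by (simp add: mult.commute)
    qed
  qed
qed

text \<open>Isolates what differentiation under the integral uses about Sobolev loops: evaluation is
  linear, yields continuous functions on a compact space, and its sup norm is dominated by the norm.
  The Sobolev norm itself is hidden behind \<open>C\<close>.\<close>

locale sup_embedding =
  fixes J :: "'w::real_normed_vector \<Rightarrow> 's::metric_space \<Rightarrow> 'e::real_normed_vector"
    and M :: "'s measure" and C :: real
  assumes compact_UNIV: "compact (UNIV :: 's set)"
    and sets_M: "sets M = sets borel" and finite_M: "finite_measure M"
    and J_add: "J (a + b) s = J a s + J b s" and J_scaleR: "J (r *\<^sub>R a) s = r *\<^sub>R J a s"
    and J_cont: "continuous_on UNIV (J a)"
    and J_bound: "norm (J a s) \<le> C * norm a"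
begin

lemma continuous_bounded:
  fixes f :: "'s \<Rightarrow> 'b::real_normed_vector"
  assumes "continuous_on UNIV f"
  obtains m where "0 \<le> m" "\<And>s. norm (f s) \<le> m"
proof -
  have "bounded (range f)"
    by (rule compact_imp_bounded[OF compact_continuous_image[OF assms compact_UNIV]])
  then obtain m where m: "\<And>s. norm (f s) \<le> m" by (auto simp: bounded_iff)
  show thesis by (rule that[OF order_trans[OF norm_ge_zero m] m])
qed

lemma integrable_continuous:
  fixes f :: "'s \<Rightarrow> 'b::{banach, second_countable_topology}"
  assumes "continuous_on UNIV f"
  shows "integrable M f"
proof -
  interpret finite_measure M by (rule finite_M)
  obtain c where "\<And>s. norm (f s) \<le> c" using continuous_bounded[OF assms] by blast
  moreover have "f \<in> borel_measurable M"
    using borel_measurable_continuous_onI[OF assms] by (simp cong: measurable_cong_sets add: sets_M)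
  ultimately show ?thesis by (intro integrable_const_bound[of _ c]) auto
qed

definition integral_form :: "('s \<Rightarrow> 'e \<Rightarrow>\<^sub>L 'e \<Rightarrow>\<^sub>L real) \<Rightarrow> 'w \<Rightarrow>\<^sub>L 'w \<Rightarrow>\<^sub>L real" where
  "integral_form \<phi> = bilin (\<lambda>a b. LINT s|M. \<phi> s (J a s) (J b s))"

lemma integrable_form:
  assumes "continuous_on UNIV \<phi>"
  shows "integrable M (\<lambda>s. blinfun_apply (blinfun_apply (\<phi> s) (J a s)) (J b s) :: real)"
  by (intro integrable_continuous continuous_intros assms J_cont)

text \<open>The factor \<open>C\<^sup>2\<close> arises because each of the two arguments is
  estimated in the sup norm; the total mass comes from integrating a constant.\<close>

lemma integral_form_bound:
  fixes \<phi> :: "'s \<Rightarrow> 'e \<Rightarrow>\<^sub>L 'e \<Rightarrow>\<^sub>L real"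
  assumes "continuous_on UNIV \<phi>" and m: "\<And>s. norm (\<phi> s) \<le> m"
  shows "norm (LINT s|M. \<phi> s (J a s) (J b s)) \<le> (m * C\<^sup>2 * measure M (space M)) * norm a * norm b"
proof -
  interpret finite_measure M by (rule finite_M)
  have m0: "0 \<le> m" by (rule order_trans[OF norm_ge_zero m])
  have "norm (\<phi> s (J a s) (J b s)) \<le> m * C\<^sup>2 * norm a * norm b" for s
  proof -
    have "norm (\<phi> s (J a s) (J b s)) \<le> norm (\<phi> s) * norm (J a s) * norm (J b s)"
      by (rule norm_blinfun2)
    also have "\<dots> \<le> m * (C * norm a) * (C * norm b)"
      by (intro mult_mono m J_bound norm_ge_zero m0
          mult_nonneg_nonneg[OF m0 order_trans[OF norm_ge_zero J_bound]])
    finally show ?thesis by (simp add: power2_eq_square ac_simps)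
  qed
  then have "norm (LINT s|M. \<phi> s (J a s) (J b s)) \<le> (LINT s|M. m * C\<^sup>2 * norm a * norm b)"
    by (intro order_trans[OF integral_norm_bound] Bochner_Integration.integral_mono integrable_norm integrable_form assms) auto
  then show ?thesis by (simp add: ac_simps)
qed

lemma integral_form_apply:
  assumes "continuous_on UNIV \<phi>"
  shows "integral_form \<phi> a b = (LINT s|M. \<phi> s (J a s) (J b s))"
proof -
  obtain m where m: "\<And>s. norm (\<phi> s) \<le> m" using continuous_bounded[OF assms] by blast
  have "bounded_bilinear (\<lambda>a b. LINT s|M. \<phi> s (J a s) (J b s))"
  proof
    show "\<exists>K. \<forall>a b. norm (LINT s|M. \<phi> s (J a s) (J b s)) \<le> norm a * norm b * K"
      using integral_form_bound[OF assms m] by (intro exI[of _ "m * C\<^sup>2 * measure M (space M)"]) (simp add: ac_simps)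
  qed (simp_all add: J_add J_scaleR blinfun.bilinear_simps integrable_form assms)
  then show ?thesis unfolding integral_form_def by (rule bilin_apply)
qed

lemma norm_integral_form:
  assumes "continuous_on UNIV \<phi>" "0 \<le> m" "\<And>s. norm (\<phi> s) \<le> m"
  shows "norm (integral_form \<phi>) \<le> m * C\<^sup>2 * measure M (space M)"
  by (rule norm_blinfun2_bound)
    (use integral_form_bound[OF assms(1,3)] assms(2) in \<open>auto simp: integral_form_apply[OF assms(1)]\<close>)

text \<open>The remainder is itself an \<open>integral_form\<close>, that of the pointwise
  linearization errors. Their uniform bound from \<open>uniform_linearization\<close>, inserted into
  \<open>norm_integral_form\<close>, is already an estimate in operator norm, so no limit theorem
  for integrals enters.\<close>

lemma has_derivative_integral_form:
  fixes \<beta> :: "'s \<times> 'e \<Rightarrow> 'e \<Rightarrow>\<^sub>L 'e \<Rightarrow>\<^sub>L real" and \<beta>' :: "'s \<times> 'e \<Rightarrow> 'e \<Rightarrow>\<^sub>L 'e \<Rightarrow>\<^sub>L 'e \<Rightarrow>\<^sub>L real"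
  assumes U: "open U" and cont: "continuous_on U \<beta>" and cont': "continuous_on U \<beta>'"
    and deriv: "\<And>s z. (s, z) \<in> U \<Longrightarrow> ((\<lambda>z. \<beta> (s, z)) has_derivative \<beta>' (s, z)) (at z)"
    and graph: "\<And>s. (s, J u s) \<in> U"
  shows "((\<lambda>u. integral_form (\<lambda>s. \<beta> (s, J u s))) has_derivative
           (\<lambda>w. integral_form (\<lambda>s. \<beta>' (s, J u s) (J w s)))) (at u)"
proof -
  have cu: "continuous_on UNIV (\<lambda>s. \<gamma> (s, J v s))"
    if "continuous_on U \<gamma>" "\<And>s. (s, J v s) \<in> U" for \<gamma> :: "'s \<times> 'e \<Rightarrow> 'd::topological_space" and v
    by (rule continuous_on_compose2[OF that(1)]) (auto intro!: continuous_intros J_cont that(2))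
  define D where "D = (\<lambda>w. integral_form (\<lambda>s. \<beta>' (s, J u s) (J w s)))"
  have c': "continuous_on UNIV (\<lambda>s. \<beta>' (s, J u s) (J w s))" for w
    by (intro continuous_intros J_cont cu cont' graph)
  obtain m where m: "0 \<le> m" "\<And>s. norm (\<beta>' (s, J u s)) \<le> m"
    using continuous_bounded[OF cu[OF cont' graph]] by blast
  define K where "K = C\<^sup>2 * measure M (space M)"
  have K: "0 \<le> K" by (simp add: K_def)
  \<comment> \<open>\<open>C\<close> carries no sign assumption; \<open>J_bound\<close> still forces
    this product to be nonnegative.\<close>
  have Cw: "0 \<le> C * norm w" for w :: 'w
    using order_trans[OF norm_ge_zero J_bound] .
  have D: "bounded_linear D"
  proof
    fix a b r
    show "D (a + b) = D a + D b"
      unfolding D_def by (intro blinfun_eqI)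
        (simp add: integral_form_apply c' continuous_on_add J_add blinfun.bilinear_simps
          integrable_form[OF c'])
    show "D (r *\<^sub>R a) = r *\<^sub>R D a"
      unfolding D_def by (intro blinfun_eqI)
        (simp add: integral_form_apply c' continuous_on_scaleR J_scaleR blinfun.bilinear_simps)
    have "norm (D w) \<le> norm w * (m * C * K)" for w
    proof -
      have "norm (\<beta>' (s, J u s) (J w s)) \<le> m * (C * norm w)" for s
        by (rule order_trans[OF norm_blinfun]) (intro mult_mono m J_bound norm_ge_zero)
      from norm_integral_form[OF c' _ this] have "norm (D w) \<le> m * (C * norm w) * C\<^sup>2 * measure M (space M)"
        unfolding D_def using m Cw by (simp add: mult_nonneg_nonneg)
      then show ?thesis by (simp add: K_def ac_simps)
    qed
    then show "\<exists>K. \<forall>w. norm (D w) \<le> norm w * K" by blast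
  qed
  let ?B = "\<lambda>u. integral_form (\<lambda>s. \<beta> (s, J u s))"
  have "\<exists>d>0. \<forall>v. norm (v - u) < d \<longrightarrow> norm (?B v - ?B u - D (v - u)) \<le> e * norm (v - u)"
    if e: "0 < e" for e
  proof -
    \<comment> \<open>The error picks up one factor \<open>C\<close> from the increment, and
      \<open>K\<close> from the two arguments and the mass. The absolute value and the
      \<open>1\<close> keep the divisor positive.\<close>
    define e' where "e' = e / (\<bar>C\<bar> * K + 1)"
    have pos: "\<bar>C\<bar> * K + 1 > 0" using K by (smt (verit) abs_ge_zero mult_nonneg_nonneg)
    have e': "e' > 0" using e pos by (simp add: e'_def)
    obtain d where d: "d > 0" "\<And>s w. norm w < d \<Longrightarrow> (s, J u s + w) \<in> U"
      "\<And>s w. norm w < d \<Longrightarrow> norm (\<beta> (s, J u s + w) - \<beta> (s, J u s) - \<beta>' (s, J u s) w) \<le> e' * norm w"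
      using uniform_linearization[OF compact_UNIV U deriv cont' J_cont graph e'] by blast
    \<comment> \<open>This radius forces the sup norm of \<open>J (v - u)\<close> below
      \<open>d\<close>, where the linearization is valid.\<close>
    have "norm (?B v - ?B u - D (v - u)) \<le> e * norm (v - u)" if v: "norm (v - u) < d / (\<bar>C\<bar> + 1)" for v
    proof -
      define w where "w = v - u"
      have Jv: "J v s = J u s + J w s" for s using J_add[of u w s] by (simp add: w_def)
      have "norm (J w s) < d" for s
      proof -
        have "norm (J w s) \<le> (\<bar>C\<bar> + 1) * norm w"
          by (rule order_trans[OF J_bound]) (auto intro!: mult_right_mono)
        also have "\<dots> < d" using v by (simp add: w_def pos_less_divide_eq add_nonneg_pos mult.commute)
        finally show ?thesis .
      qed
      note dw = d(2)[OF this] d(3)[OF this]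
      have gv: "(s, J v s) \<in> U" for s using dw(1) by (simp add: Jv)
      define \<rho> where "\<rho> = (\<lambda>s. \<beta> (s, J v s) - \<beta> (s, J u s) - \<beta>' (s, J u s) (J w s))"
      have c\<rho>: "continuous_on UNIV \<rho>"
        unfolding \<rho>_def by (intro continuous_intros c' cu cont graph gv)
      have diff: "?B v - ?B u - D w = integral_form \<rho>"
        unfolding D_def
      proof (intro blinfun_eqI)
        fix a b
        have "integral_form \<rho> a b = (LINT s|M. \<beta> (s, J v s) (J a s) (J b s))
            - (LINT s|M. \<beta> (s, J u s) (J a s) (J b s)) - (LINT s|M. \<beta>' (s, J u s) (J w s) (J a s) (J b s))"
          by (subst integral_form_apply[OF c\<rho>])
            (simp add: \<rho>_def blinfun.bilinear_simps integrable_form c' cu cont graph gv)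
        then show "blinfun_apply (blinfun_apply (?B v - ?B u - integral_form (\<lambda>s. \<beta>' (s, J u s) (J w s))) a) b
            = integral_form \<rho> a b"
          by (simp add: integral_form_apply c' cu cont graph gv blinfun.bilinear_simps)
      qed
      have "norm (integral_form \<rho>) \<le> (e' * (C * norm w)) * C\<^sup>2 * measure M (space M)"
      proof (rule norm_integral_form[OF c\<rho>])
        show "0 \<le> e' * (C * norm w)" using e' Cw by simp
        show "norm (\<rho> s) \<le> e' * (C * norm w)" for s
          using order_trans[OF dw(2)[of s] mult_left_mono[OF J_bound[of w s]]] e' by (simp add: \<rho>_def Jv)
      qed
      also have "\<dots> = e' * (C * K) * norm w"
        by (simp add: K_def ac_simps)
      also have "\<dots> \<le> e * norm w"
      proof (rule mult_right_mono)
        have "C * K \<le> \<bar>C\<bar> * K + 1" using K by (smt (verit) abs_ge_self mult_right_mono)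
        then have "e' * (C * K) \<le> e' * (\<bar>C\<bar> * K + 1)" using e' by (intro mult_left_mono) auto
        also have "\<dots> = e" using pos by (simp add: e'_def)
        finally show "e' * (C * K) \<le> e" .
      qed simp
      finally show ?thesis using diff unfolding w_def by simp
    qed
    moreover have "d / (\<bar>C\<bar> + 1) > 0" using d(1) by (simp add: add_nonneg_pos)
    ultimately show ?thesis by blast
  qed
  then have "(?B has_derivative D) (at u)"
    unfolding has_derivative_at_alt using D by blast
  then show ?thesis by (simp add: D_def)
qed

end

section \<open>Symmetry of second derivatives and pull-backs of closed two-forms\<close>

text \<open>The mean value theorem is applied twice: to the increment of \<open>f\<close> in
  direction \<open>h *\<^sub>R w\<close> as a function of the displacement along \<open>v\<close>,
  then to \<open>f' _ v\<close> along \<open>w\<close>. Pairing with \<open>i\<close> makes these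
  functions real-valued, as an equality needs; the intermediate point may depend on
  \<open>i\<close>.\<close>

lemma second_difference_mvt:
  fixes f :: "'a::real_normed_vector \<Rightarrow> 'b::real_inner"
  assumes f: "\<And>y. y \<in> S \<Longrightarrow> (f has_derivative f' y) (at y)"
    and fv: "\<And>y. y \<in> S \<Longrightarrow> ((\<lambda>y. f' y v) has_derivative Dv y) (at y)"
    and h: "0 < h" and S: "\<And>s t. s \<in> {0..h} \<Longrightarrow> t \<in> {0..h} \<Longrightarrow> x + s *\<^sub>R v + t *\<^sub>R w \<in> S"
  shows "\<exists>s\<in>{0..h}. \<exists>t\<in>{0..h}.
    (f (x + h *\<^sub>R v + h *\<^sub>R w) - f (x + h *\<^sub>R v) - f (x + h *\<^sub>R w) + f x) \<bullet> i
      = h\<^sup>2 * (Dv (x + s *\<^sub>R v + t *\<^sub>R w) w \<bullet> i)"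
proof -
  define p where "p = (\<lambda>s t. x + s *\<^sub>R v + t *\<^sub>R w)"
  have pS: "p s t \<in> S" if "s \<in> {0..h}" "t \<in> {0..h}" for s t using S that by (simp add: p_def)
  have "\<exists>s\<in>{0<..<h}. (f (p h h) - f (p h 0)) \<bullet> i - (f (p 0 h) - f (p 0 0)) \<bullet> i
      = (\<lambda>r. (f' (p s h) (r *\<^sub>R v) - f' (p s 0) (r *\<^sub>R v)) \<bullet> i) (h - 0)"
  proof (rule mvt_simple[OF h])
    fix s assume "0 \<le> s" "s \<le> h"
    then have s: "s \<in> {0..h}" by simp
    have d: "((\<lambda>s. f (p s t)) has_derivative (\<lambda>r. f' (p s t) (r *\<^sub>R v))) (at s within {0..h})"
      if t: "t \<in> {0..h}" for t
      by (rule has_derivative_compose[of "\<lambda>s. p s t" _ _ _ f, unfolded comp_def, OF _ f[OF pS[OF s t]]])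
        (auto simp: p_def intro!: derivative_eq_intros)
    show "((\<lambda>s. (f (p s h) - f (p s 0)) \<bullet> i) has_derivative
        (\<lambda>r. (f' (p s h) (r *\<^sub>R v) - f' (p s 0) (r *\<^sub>R v)) \<bullet> i)) (at s within {0..h})"
      using h by (intro has_derivative_inner_left has_derivative_diff d) auto
  qed
  then obtain s where s0: "s \<in> {0<..<h}"
    and eq: "(f (p h h) - f (p h 0)) \<bullet> i - (f (p 0 h) - f (p 0 0)) \<bullet> i
      = (f' (p s h) (h *\<^sub>R v) - f' (p s 0) (h *\<^sub>R v)) \<bullet> i"
    unfolding diff_zero by blast
  then have s: "s \<in> {0..h}" by simp
  have lin: "f' y (h *\<^sub>R v) = h *\<^sub>R f' y v" if "y \<in> S" for y
    using has_derivative_bounded_linear[OF f[OF that]] by (simp add: linear_simps)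
  have "\<exists>t\<in>{0<..<h}. f' (p s h) v \<bullet> i - f' (p s 0) v \<bullet> i = (\<lambda>r. Dv (p s t) (r *\<^sub>R w) \<bullet> i) (h - 0)"
  proof (rule mvt_simple[OF h])
    fix t assume "0 \<le> t" "t \<le> h"
    then have t: "t \<in> {0..h}" by simp
    have "((\<lambda>t. f' (p s t) v) has_derivative (\<lambda>r. Dv (p s t) (r *\<^sub>R w))) (at t within {0..h})"
      by (rule has_derivative_compose[of "\<lambda>t. p s t" _ _ _ "\<lambda>y. f' y v", unfolded comp_def, OF _ fv[OF pS[OF s t]]])
        (auto simp: p_def intro!: derivative_eq_intros)
    then show "((\<lambda>t. f' (p s t) v \<bullet> i) has_derivative (\<lambda>r. Dv (p s t) (r *\<^sub>R w) \<bullet> i)) (at t within {0..h})"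
      by (rule has_derivative_inner_left)
  qed
  then obtain t where t0: "t \<in> {0<..<h}"
    and eq2: "f' (p s h) v \<bullet> i - f' (p s 0) v \<bullet> i = Dv (p s t) (h *\<^sub>R w) \<bullet> i"
    unfolding diff_zero by blast
  then have t: "t \<in> {0..h}" by simp
  have "Dv (p s t) (h *\<^sub>R w) = h *\<^sub>R Dv (p s t) w"
    using has_derivative_bounded_linear[OF fv[OF pS[OF s t]]] by (simp add: linear_simps)
  then have "(f' (p s h) (h *\<^sub>R v) - f' (p s 0) (h *\<^sub>R v)) \<bullet> i = h\<^sup>2 * (Dv (p s t) w \<bullet> i)"
    using h s eq2 by (simp add: lin pS inner_diff_left power2_eq_square flip: right_diff_distrib)
  then show ?thesis using eq s t
    by (intro bexI[of _ s] bexI[of _ t]) (simp_all add: p_def inner_diff_left inner_add_left)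
qed

text \<open>The second difference over a parallelogram is unchanged when \<open>v\<close> and
  \<open>w\<close> are exchanged, so after pairing with a vector the two mixed derivatives agree at
  two points close to \<open>x\<close>; continuity at \<open>x\<close> closes the gap.\<close>

lemma second_derivative_symmetric:
  fixes f :: "'a::real_normed_vector \<Rightarrow> 'b::real_inner"
  assumes "open S" and x: "x \<in> S"
    and f: "\<And>y. y \<in> S \<Longrightarrow> (f has_derivative f' y) (at y)"
    and fv: "\<And>y. y \<in> S \<Longrightarrow> ((\<lambda>y. f' y v) has_derivative Dv y) (at y)"
    and fw: "\<And>y. y \<in> S \<Longrightarrow> ((\<lambda>y. f' y w) has_derivative Dw y) (at y)"
    and cv: "isCont (\<lambda>y. Dv y w) x" and cw: "isCont (\<lambda>y. Dw y v) x"
  shows "Dv x w = Dw x v"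
proof -
  \<comment> \<open>Testing against the difference itself turns the pairing into
    \<open>norm i ^ 2\<close>, which is then below every positive \<open>e\<close>.\<close>
  define i where "i = Dv x w - Dw x v"
  have "norm i ^ 2 < e" if e: "e > 0" for e
  proof -
    have c1: "isCont (\<lambda>y. Dv y w \<bullet> i) x" and c2: "isCont (\<lambda>y. Dw y v \<bullet> i) x"
      by (intro continuous_intros cv cw)+
    have e2: "e / 2 > 0" using e by simp
    from c1 e2 obtain d1 where d1: "d1 > 0" "\<And>y. dist y x < d1 \<Longrightarrow> \<bar>Dv y w \<bullet> i - Dv x w \<bullet> i\<bar> < e / 2"
      unfolding continuous_at_eps_delta dist_real_def by blast
    from c2 e2 obtain d2 where d2: "d2 > 0" "\<And>y. dist y x < d2 \<Longrightarrow> \<bar>Dw y v \<bullet> i - Dw x v \<bullet> i\<bar> < e / 2"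
      unfolding continuous_at_eps_delta dist_real_def by blast
    obtain d3 where d3: "d3 > 0" "ball x d3 \<subseteq> S" using \<open>open S\<close> x open_contains_ball by blast
    define d where "d = min d1 (min d2 d3)"
    \<comment> \<open>Small enough that the parallelogram with sides \<open>h *\<^sub>R v\<close>
      and \<open>h *\<^sub>R w\<close> lies within \<open>d\<close> of \<open>x\<close>; the
      \<open>1\<close> makes the estimate strict and covers \<open>v = w = 0\<close>.\<close>
    define h where "h = d / (norm v + norm w + 1)"
    have d: "d > 0" using d1 d2 d3 by (simp add: d_def)
    have h: "h > 0" using d by (simp add: h_def add_nonneg_pos)
    have near: "dist (x + s *\<^sub>R v + t *\<^sub>R w) x < d" if "s \<in> {0..h}" "t \<in> {0..h}" for s t
    proof -
      have "norm (s *\<^sub>R v + t *\<^sub>R w) \<le> h * norm v + h * norm w"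
        using that by (intro order_trans[OF norm_triangle_ineq] add_mono) (auto intro!: mult_right_mono)
      also have "\<dots> < h * (norm v + norm w + 1)" using h by (simp add: algebra_simps)
      also have "\<dots> = d" unfolding h_def by (simp add: add_nonneg_pos pos_add_strict less_imp_neq[symmetric])
      finally show ?thesis by (simp add: dist_norm add.assoc)
    qed
    have S: "x + s *\<^sub>R v + t *\<^sub>R w \<in> S" if "s \<in> {0..h}" "t \<in> {0..h}" for s t
      using near[OF that] d3 by (auto simp: d_def dist_commute subset_iff)
    have S': "x + s *\<^sub>R w + t *\<^sub>R v \<in> S" if "s \<in> {0..h}" "t \<in> {0..h}" for s t
      using S[OF that(2,1)] by (simp add: ac_simps)
    obtain s t where st: "s \<in> {0..h}" "t \<in> {0..h}"
      and 1: "(f (x + h *\<^sub>R v + h *\<^sub>R w) - f (x + h *\<^sub>R v) - f (x + h *\<^sub>R w) + f x) \<bullet> i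
        = h\<^sup>2 * (Dv (x + s *\<^sub>R v + t *\<^sub>R w) w \<bullet> i)"
      using second_difference_mvt[OF f fv h S] by blast
    obtain s' t' where st': "s' \<in> {0..h}" "t' \<in> {0..h}"
      and 2: "(f (x + h *\<^sub>R w + h *\<^sub>R v) - f (x + h *\<^sub>R w) - f (x + h *\<^sub>R v) + f x) \<bullet> i
        = h\<^sup>2 * (Dw (x + s' *\<^sub>R w + t' *\<^sub>R v) v \<bullet> i)"
      using second_difference_mvt[OF f fw h S'] by blast
    have swap: "(f (x + h *\<^sub>R w + h *\<^sub>R v) - f (x + h *\<^sub>R w) - f (x + h *\<^sub>R v) + f x)
      = (f (x + h *\<^sub>R v + h *\<^sub>R w) - f (x + h *\<^sub>R v) - f (x + h *\<^sub>R w) + f x)"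
      by (simp add: algebra_simps)
    from trans[OF sym[OF 1] 2[unfolded swap]]
    have eq: "Dv (x + s *\<^sub>R v + t *\<^sub>R w) w \<bullet> i = Dw (x + s' *\<^sub>R w + t' *\<^sub>R v) v \<bullet> i"
      using h by simp
    have "\<bar>Dv (x + s *\<^sub>R v + t *\<^sub>R w) w \<bullet> i - Dv x w \<bullet> i\<bar> < e / 2"
      using d1(2) near[OF st] by (simp add: d_def)
    moreover have "\<bar>Dw (x + s' *\<^sub>R w + t' *\<^sub>R v) v \<bullet> i - Dw x v \<bullet> i\<bar> < e / 2"
      using d2(2) near[OF st'(2,1)] by (simp add: d_def ac_simps)
    ultimately have "Dv x w \<bullet> i - Dw x v \<bullet> i < e" using eq by linarith
    then show ?thesis by (simp add: i_def inner_diff_left power2_norm_eq_inner inner_diff_right)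
  qed
  then have "norm i ^ 2 \<le> 0" by (meson less_irrefl not_le)
  then show ?thesis by (simp add: i_def)
qed

lemma smooth_on_derivs:
  assumes "smooth_on S f"
  shows smooth_on_differentiable: "x \<in> S \<Longrightarrow> f differentiable (at x)"
    and smooth_on_deriv_differentiable:
      "x \<in> S \<Longrightarrow> (\<lambda>x. frechet_derivative f (at x) v) differentiable (at x)"
    and smooth_on_continuous_deriv: "continuous_on S (\<lambda>x. frechet_derivative f (at x) v)"
    and smooth_on_continuous_deriv2:
      "continuous_on S (\<lambda>x. frechet_derivative (\<lambda>x. frechet_derivative f (at x) v) (at x) w)"
proof -
  have 1: "Ck_on (Suc 0) S f" and 2: "Ck_on (Suc (Suc 0)) S f"
    using assms unfolding smooth_on_def by blast+
  show "x \<in> S \<Longrightarrow> f differentiable (at x)" "continuous_on S (\<lambda>x. frechet_derivative f (at x) v)"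
    using 1 by auto
  show "x \<in> S \<Longrightarrow> (\<lambda>x. frechet_derivative f (at x) v) differentiable (at x)"
    "continuous_on S (\<lambda>x. frechet_derivative (\<lambda>x. frechet_derivative f (at x) v) (at x) w)"
    using 2 by auto
qed

lemma smooth_on_second_derivative_symmetric:
  fixes f :: "'a::real_normed_vector \<Rightarrow> 'b::real_inner"
  assumes "open S" "smooth_on S f" "x \<in> S"
  shows "frechet_derivative (\<lambda>x. frechet_derivative f (at x) v) (at x) w
    = frechet_derivative (\<lambda>x. frechet_derivative f (at x) w) (at x) v"
proof -
  have "isCont (\<lambda>y. frechet_derivative (\<lambda>x. frechet_derivative f (at x) a) (at y) b) x" for a b
    using smooth_on_continuous_deriv2[OF assms(2), of a b] assms(1,3)
    by (simp add: continuous_on_eq_continuous_at)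
  then show ?thesis
    by (intro second_derivative_symmetric[OF assms(1,3), where f = f
          and f' = "\<lambda>x. frechet_derivative f (at x)"])
      (auto simp: frechet_derivative_works[symmetric] smooth_on_derivs[OF assms(2)])
qed

section \<open>Pull-back of a closed two-form along a map with a real parameter\<close>

lemma slice_has_derivative:
  assumes "(F has_derivative D) (at (t, z))"
  shows "((\<lambda>z. F (t, z)) has_derivative (\<lambda>a. D (0, a))) (at z)"
  by (rule has_derivative_compose[of "\<lambda>z. (t, z)" _ _ _ F, unfolded comp_def, OF _ assms])
    (auto intro!: derivative_eq_intros)

text \<open>The product rule leaves, next to the pulled-back derivative of \<open>B\<close>, terms
  with second derivatives of \<open>F\<close>. These vanish under alternation, by symmetry of second
  derivatives and antisymmetry of \<open>B\<close>. The real coordinate is a parameter: only fibre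
  vectors \<open>(0, b)\<close> are inserted, yet continuity is joint in both coordinates.\<close>

lemma pullback_closed_2form:
  fixes F :: "real \<times> 'e::euclidean_space \<Rightarrow> 'f::euclidean_space"
    and B :: "'f \<Rightarrow> 'f \<Rightarrow>\<^sub>L 'f \<Rightarrow>\<^sub>L real" and \<beta> :: "real \<times> 'e \<Rightarrow> 'e \<Rightarrow>\<^sub>L 'e \<Rightarrow>\<^sub>L real"
  assumes S: "open S" and F: "smooth_on S F" and FV: "F ` S \<subseteq> V"
    and B: "\<And>y. y \<in> V \<Longrightarrow> B differentiable (at y)"
    and B_anti: "\<And>y a b. y \<in> V \<Longrightarrow> B y a b = - B y b a"
    and B_closed: "\<And>y a b c. y \<in> V \<Longrightarrow> ext_deriv2 B y a b c = 0"
    and B_cont: "\<And>a b c. continuous_on V (\<lambda>y. frechet_derivative B (at y) a b c)"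
    and \<beta>: "\<And>p b c. p \<in> S \<Longrightarrow>
      \<beta> p b c = B (F p) (frechet_derivative F (at p) (0, b)) (frechet_derivative F (at p) (0, c))"
  defines "\<beta>' \<equiv> \<lambda>p. Blinfun (frechet_derivative (\<lambda>z. \<beta> (fst p, z)) (at (snd p)))"
  shows "p \<in> S \<Longrightarrow> ((\<lambda>z. \<beta> (fst p, z)) has_derivative \<beta>' p) (at (snd p))"
    and "continuous_on S \<beta>" and "continuous_on S \<beta>'"
    and "p \<in> S \<Longrightarrow> \<beta>' p a b c - \<beta>' p b a c + \<beta>' p c a b = 0"
proof -
  \<comment> \<open>\<open>G\<close> and \<open>H\<close> are the first and second fibre derivatives
    of \<open>F\<close>, and \<open>T\<close> is what the product rule yields for
    \<open>\<beta>\<close>.\<close>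
  define G where "G = (\<lambda>p b. frechet_derivative F (at p) (0 :: real, b :: 'e))"
  define H where "H = (\<lambda>p a b. frechet_derivative (\<lambda>p. G p b) (at p) (0 :: real, a :: 'e))"
  define D where "D = (\<lambda>y. Blinfun (frechet_derivative B (at y)))"
  define T where "T = (\<lambda>p a b c. D (F p) (G p a) (G p b) (G p c) + B (F p) (H p a b) (G p c)
    + B (F p) (G p b) (H p a c))"
  have dB: "(B has_derivative D y) (at y)" if "y \<in> V" for y
    using B[OF that] unfolding D_def
    by (simp add: frechet_derivative_works bounded_linear_Blinfun_apply has_derivative_bounded_linear)
  then have D: "frechet_derivative B (at y) = D y" if "y \<in> V" for y
    using that frechet_derivative_at[OF dB] by metis
  have V: "F p \<in> V" if "p \<in> S" for p using FV that by blast
  have dF: "(F has_derivative frechet_derivative F (at p)) (at p)" if "p \<in> S" for p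
    using smooth_on_differentiable[OF F that] by (simp add: frechet_derivative_works)
  have F_cont: "continuous_on S F"
    by (intro continuous_at_imp_continuous_on ballI has_derivative_continuous[OF dF])
  have dG: "((\<lambda>p. G p b) has_derivative frechet_derivative (\<lambda>p. G p b) (at p)) (at p)" if "p \<in> S" for p b
    using smooth_on_deriv_differentiable[OF F that] unfolding G_def by (simp add: frechet_derivative_works)
  have G_cont: "continuous_on S (\<lambda>p. G p b)" for b
    unfolding G_def by (rule smooth_on_continuous_deriv[OF F])
  have H_cont: "continuous_on S (\<lambda>p. H p a b)" for a b
    unfolding H_def G_def by (rule smooth_on_continuous_deriv2[OF F])
  have H_sym: "H p a b = H p b a" if "p \<in> S" for p a b
    unfolding H_def G_def by (rule smooth_on_second_derivative_symmetric[OF S F that])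
  have D_cont: "continuous_on V D"
  proof (intro continuous_on_blinfun_componentwise)
    fix i j k :: 'f
    show "continuous_on V (\<lambda>y. D y i j k)"
      by (rule continuous_on_eq[OF B_cont]) (simp add: D)
  qed
  have B_cont0: "continuous_on V B"
    by (intro continuous_at_imp_continuous_on ballI has_derivative_continuous[OF dB])
  have dT: "((\<lambda>z. \<beta> (t, z) b c) has_derivative (\<lambda>a. T (t, z) a b c)) (at z)" if p: "(t, z) \<in> S" for t z b c
  proof -
    have d1: "((\<lambda>z. F (t, z)) has_derivative G (t, z)) (at z)"
      using slice_has_derivative[OF dF[OF p]] by (simp add: G_def)
    have d2: "((\<lambda>z. B (F (t, z))) has_derivative (\<lambda>a. D (F (t, z)) (G (t, z) a))) (at z)"
      by (rule has_derivative_compose[OF d1 dB[OF V[OF p]]])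
    have d3: "((\<lambda>z. G (t, z) b) has_derivative (\<lambda>a. H (t, z) a b)) (at z)" for b
      using slice_has_derivative[OF dG[OF p]] by (simp add: H_def)
    have "((\<lambda>z. B (F (t, z)) (G (t, z) b) (G (t, z) c)) has_derivative (\<lambda>a. T (t, z) a b c)) (at z)"
      by (rule has_derivative_eq_rhs[OF blinfun.FDERIV[OF blinfun.FDERIV[OF d2 d3] d3]])
        (simp add: T_def blinfun.add_left fun_eq_iff ac_simps)
    moreover have "open ((\<lambda>z. (t, z)) -` S)"
      by (intro open_vimage[OF S] continuous_intros)
    ultimately show ?thesis
      by (rule has_derivative_transform_within_open) (use p in \<open>auto simp: \<beta> G_def\<close>)
  qed
  have d\<beta>: "((\<lambda>z. \<beta> (fst p, z)) has_derivative \<beta>' p) (at (snd p))" if p: "p \<in> S" for p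
  proof -
    have "(\<lambda>z. \<beta> (fst p, z)) differentiable (at (snd p))"
      by (intro differentiable_blinfun_componentwise differentiableI[OF dT]) (simp add: p)
    then show ?thesis unfolding \<beta>'_def
      by (simp add: frechet_derivative_works bounded_linear_Blinfun_apply has_derivative_bounded_linear)
  qed
  have \<beta>'_eq: "\<beta>' p a b c = T p a b c" if p: "p \<in> S" for p a b c
  proof -
    have "((\<lambda>z. \<beta> (fst p, z) b c) has_derivative (\<lambda>a. \<beta>' p a b c)) (at (snd p))"
      by (intro bounded_linear.has_derivative[OF blinfun.bounded_linear_left] d\<beta> p)
    moreover have "((\<lambda>z. \<beta> (fst p, z) b c) has_derivative (\<lambda>a. T p a b c)) (at (snd p))"
      using dT[of "fst p" "snd p"] p by simp
    ultimately have "(\<lambda>a. \<beta>' p a b c) = (\<lambda>a. T p a b c)" by (rule has_derivative_unique)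
    then show ?thesis by metis
  qed
  show "((\<lambda>z. \<beta> (fst p, z)) has_derivative \<beta>' p) (at (snd p))" if "p \<in> S" by (rule d\<beta>[OF that])
  have comp: "continuous_on S (\<lambda>p. B (F p))" "continuous_on S (\<lambda>p. D (F p))"
    by (rule continuous_on_compose2[OF B_cont0 F_cont FV] continuous_on_compose2[OF D_cont F_cont FV])+
  show "continuous_on S \<beta>"
  proof (intro continuous_on_blinfun_componentwise)
    fix b c :: 'e
    have "continuous_on S (\<lambda>p. B (F p) (G p b) (G p c))"
      by (intro continuous_intros comp G_cont)
    then show "continuous_on S (\<lambda>p. \<beta> p b c)"
      by (rule continuous_on_eq) (simp add: \<beta> G_def)
  qed
  show "continuous_on S \<beta>'"
  proof (intro continuous_on_blinfun_componentwise)
    fix a b c :: 'e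
    have "continuous_on S (\<lambda>p. T p a b c)"
      unfolding T_def by (intro continuous_intros comp G_cont H_cont)
    then show "continuous_on S (\<lambda>p. \<beta>' p a b c)"
      by (rule continuous_on_eq) (simp add: \<beta>'_eq)
  qed
  show "\<beta>' p a b c - \<beta>' p b a c + \<beta>' p c a b = 0" if p: "p \<in> S"
  proof -
    have "D (F p) (G p a) (G p b) (G p c) - D (F p) (G p b) (G p a) (G p c)
        + D (F p) (G p c) (G p a) (G p b) = 0"
      using B_closed[OF V[OF p], of "G p a" "G p b" "G p c"] D[OF V[OF p]] by (simp add: ext_deriv2_def)
    \<comment> \<open>Of the six terms with \<open>H\<close>, four cancel by symmetry of
      \<open>H\<close> alone; the other two, \<open>B (F p) (G p b) (H p a c)\<close> and
      \<open>B (F p) (H p c a) (G p b)\<close>, need the antisymmetry of \<open>B\<close> as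
      well.\<close>
    then show ?thesis
      using H_sym[OF p, of b a] H_sym[OF p, of c a] H_sym[OF p, of c b]
        B_anti[OF V[OF p], of "G p b" "H p a c"]
      by (simp add: \<beta>'_eq[OF p] T_def)
  qed
qed

section \<open>The circle and the Sobolev embedding\<close>

lemma Rep_circle_exp [simp]: "Rep_circle (circle_exp t) = cis t"
  unfolding circle_exp_def by (rule Abs_circle_inverse) simp

lemma continuous_Rep_circle: "continuous_on S Rep_circle"
  unfolding continuous_on_iff by (auto simp: dist_circle_def)

lemma continuous_circle_exp: "continuous_on S circle_exp"
proof -
  have "continuous_on S cis" by (intro continuous_intros)
  then show ?thesis unfolding continuous_on_iff by (simp add: dist_circle_def)
qed

lemma compact_circle: "compact (UNIV :: circle set)"
proof -
  have "UNIV = circle_exp ` {0..2 * pi}" using circle_exp_surj by blast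
  then show ?thesis by (metis compact_continuous_image[OF continuous_circle_exp compact_Icc])
qed

text \<open>A right inverse of \<open>circle_exp\<close> on the whole circle; only its continuity is local.\<close>

definition circle_lift :: "real \<Rightarrow> circle \<Rightarrow> real" where
  "circle_lift t s = t + Arg (Rep_circle s / cis t)"

lemma circle_exp_lift [simp]: "circle_exp (circle_lift t s) = s"
proof -
  have n: "norm (Rep_circle s / cis t) = 1" using Rep_circle[of s] by (simp add: norm_divide)
  then have "Rep_circle s \<noteq> 0" by auto
  then have "cis (Arg (Rep_circle s / cis t)) = Rep_circle s / cis t"
    using n cis_Arg[of "Rep_circle s / cis t"] by (auto simp: sgn_div_norm)
  then have "Rep_circle (circle_exp (circle_lift t s)) = Rep_circle s"
    by (simp add: circle_lift_def cis_mult[symmetric])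
  then show ?thesis by (simp only: Rep_circle_inject)
qed

lemma circle_lift_exp [simp]: "circle_lift t (circle_exp t) = t"
  by (simp add: circle_lift_def)

text \<open>Dividing by \<open>cis t\<close> moves the point in question to \<open>1\<close>, away
  from the branch cut of \<open>Arg\<close>.\<close>

lemma isCont_circle_lift: "isCont (circle_lift t) (circle_exp t)"
proof -
  have "isCont Rep_circle (circle_exp t)"
    using continuous_Rep_circle[of UNIV] by (simp add: continuous_on_eq_continuous_at)
  then have c: "isCont (\<lambda>s. Rep_circle s / cis t) (circle_exp t)"
    by (intro continuous_intros) auto
  have "isCont Arg (Rep_circle (circle_exp t) / cis t)"
    by (intro continuous_at_Arg) auto
  from isCont_o2[OF c this] show ?thesis
    unfolding circle_lift_def by (intro continuous_intros)
qed

text \<open>\<open>f\<close> is the composite of \<open>\<lambda>t. f (circle_exp t)\<close> with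
  \<open>circle_lift t\<close>, so continuity of the lift at this one point suffices.\<close>

lemma isCont_circle_fun:
  assumes "isCont (\<lambda>t. f (circle_exp t)) t"
  shows "isCont f (circle_exp t)"
  using isCont_o2[OF isCont_circle_lift, where g = "\<lambda>t. f (circle_exp t)"] assms by simp

lemma isCont_circle_prod:
  fixes f :: "circle \<times> 'a::t2_space \<Rightarrow> 'b::topological_space"
  assumes "isCont (\<lambda>p. f (circle_exp (fst p), snd p)) (t, z)"
  shows "isCont f (circle_exp t, z)"
proof -
  have "isCont (\<lambda>p. (circle_lift t (fst p), snd p)) (circle_exp t, z)"
    by (intro continuous_intros isCont_o2[where g = "circle_lift t" and f = fst])
      (simp add: isCont_circle_lift)
  from isCont_o2[OF this, where g = "\<lambda>p. f (circle_exp (fst p), snd p)"] assms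
  show ?thesis by simp
qed

section \<open>Sobolev embedding into the continuous loops\<close>

lemma sobolev_circle_isCont:
  fixes f :: "circle \<Rightarrow> 'a::euclidean_space"
  assumes f: "sobolev_circle k f" and k: "0 < k"
  shows "isCont f s"
proof -
  obtain t where t: "s = circle_exp t" using circle_exp_surj by blast
  \<comment> \<open>An interval with \<open>t\<close> in its interior: on \<open>{0..2 * pi}\<close>
    the point \<open>circle_exp 0\<close> would be approached from one side only at each
    end.\<close>
  obtain d where d: "sobolev_derivs k (t - 1) (t + 1) (f \<circ> circle_exp) d"
    using f unfolding sobolev_circle_def sobolev_on_def by (metis less_add_one diff_less_eq less_trans)
  have "continuous_on {t - 1..t + 1} (\<lambda>t. f (circle_exp t))"
    by (rule continuous_on_eq[OF sobolev_derivs_continuous[OF d k]])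
      (simp add: sobolev_derivs_0[OF d])
  then have "continuous_on {t - 1<..<t + 1} (\<lambda>t. f (circle_exp t))"
    by (rule continuous_on_subset) auto
  then have "isCont (\<lambda>t. f (circle_exp t)) t"
    by (simp add: continuous_on_eq_continuous_at)
  then show ?thesis unfolding t by (rule isCont_circle_fun)
qed

text \<open>Deviation from the value at the base point is controlled by the L1 norm of the
  derivative, and the average of the norm by the L1 norm of \<open>f\<close>. Here
  \<open>2 * pi + 1\<close> bounds both L1 norms, being the length of the interval plus the bound on
  the square integral. The factor 3 counts two comparisons with the base point and one
  average.\<close>

lemma sobolev_circle_bound:
  fixes f :: "circle \<Rightarrow> 'a::euclidean_space"
  assumes f: "sobolev_circle k f" and k: "0 < k" and le1: "sobolev_inner k f f \<le> 1"
  shows "norm (f s) \<le> 3 * (2 * pi + 1)"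
proof -
  let ?I = "{0..2 * pi}" and ?c = "2 * pi + 1"
  define d where "d = weak_deriv k f"
  have d: "sobolev_derivs k 0 (2 * pi) (f \<circ> circle_exp) d"
    unfolding d_def by (rule weak_deriv[OF f])
  have int: "set_integrable lborel ?I (\<lambda>t. norm (d j t))" if "j \<le> k" for j
    by (rule set_integrable_norm[OF sobolev_derivs_integrable[OF d that]])
  have one: "set_integrable lborel ?I (\<lambda>t. c)" for c :: real
    by (intro borel_integrable_atLeastAtMost' continuous_intros)
  have L1: "(LBINT t:?I. norm (d j t)) \<le> ?c" if j: "j \<le> k" for j
  proof -
    note sq = sobolev_derivs_meas(2)[OF d j]
    have "(LBINT t:?I. (norm (d j t))\<^sup>2) \<le> sobolev_inner k f f"
      unfolding sobolev_inner_def power2_norm_eq_inner d_def using j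
      by (intro member_le_sum[where f = "\<lambda>j. LBINT t:?I. weak_deriv k f j t \<bullet> weak_deriv k f j t"])
        (auto simp: set_lebesgue_integral_def intro!: Bochner_Integration.integral_nonneg)
    then have "(LBINT t:?I. (norm (d j t))\<^sup>2) \<le> 1" using le1 by linarith
    moreover have "(LBINT t:?I. norm (d j t)) \<le> (LBINT t:?I. 1 + (norm (d j t))\<^sup>2)"
    proof (rule set_integral_mono[OF int[OF j] set_integral_add(1)[OF one sq]])
      have "x \<le> 1 + x\<^sup>2" for x :: real
        using zero_le_power2[of "x - 1/2"] by (simp add: power2_eq_square algebra_simps)
      then show "norm (d j t) \<le> 1 + (norm (d j t))\<^sup>2" for t .
    qed
    moreover have "(LBINT t:?I. 1 + (norm (d j t))\<^sup>2) = 2 * pi + (LBINT t:?I. (norm (d j t))\<^sup>2)"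
      using set_integral_add(2)[OF one[of 1] sq] by (simp add: set_integral_const)
    ultimately show ?thesis by linarith
  qed
  have osc: "norm (d 0 t - d 0 0) \<le> ?c" if t: "t \<in> ?I" for t
  proof -
    have i: "set_integrable lborel {0..t} (d 1)"
      by (rule set_integrable_subset[OF sobolev_derivs_integrable[OF d]]) (use k t in auto)
    have "norm (LBINT s:{0..t}. d 1 s) \<le> (LBINT s:{0..t}. norm (d 1 s))"
      by (rule set_integral_norm_bound[OF i])
    also have "\<dots> \<le> (LBINT s:?I. norm (d 1 s))"
      unfolding set_lebesgue_integral_def
    proof (rule Bochner_Integration.integral_mono)
      show "integrable lborel (\<lambda>s. indicat_real {0..t} s *\<^sub>R norm (d 1 s))"
        using set_integrable_norm[OF i] by (simp add: set_integrable_def)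
      show "integrable lborel (\<lambda>s. indicat_real ?I s *\<^sub>R norm (d 1 s))"
        using int[of 1] k by (simp add: set_integrable_def)
    qed (use t in \<open>auto simp: indicator_def\<close>)
    also have "\<dots> \<le> ?c" using L1[of 1] k by simp
    finally show ?thesis using sobolev_derivs_ftc[OF d k t] by simp
  qed
  have bound: "norm (d 0 t) \<le> 3 * ?c" if t: "t \<in> ?I" for t
  proof -
    have "norm (d 0 t) - 2 * ?c \<le> norm (d 0 t')" if t': "t' \<in> ?I" for t'
      using osc[OF t] osc[OF t'] by norm
    then have "(LBINT t':?I. norm (d 0 t) - 2 * ?c) \<le> (LBINT t':?I. norm (d 0 t'))"
      by (intro set_integral_mono one int) auto
    also have "\<dots> \<le> ?c" by (rule L1) simp
    finally have "2 * pi * (norm (d 0 t) - 2 * ?c) \<le> ?c" by (simp add: set_integral_const)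
    \<comment> \<open>Averaging gives the bound \<open>?c / (2 * pi)\<close>, which is at most
      \<open>?c\<close> because \<open>2 * pi \<ge> 1\<close>.\<close>
    moreover have "2 * pi * ?c \<ge> 1 * ?c" using pi_gt3 by (intro mult_right_mono) auto
    ultimately have "2 * pi * (norm (d 0 t) - 2 * ?c) \<le> 2 * pi * ?c"
      unfolding mult_1_left by (rule order_trans)
    then have "norm (d 0 t) - 2 * ?c \<le> ?c" by (rule mult_left_le_imp_le) simp
    then show ?thesis by (simp add: algebra_simps)
  qed
  obtain t where "t \<in> ?I" "s = circle_exp t" using circle_exp_surj by blast
  then show ?thesis using bound sobolev_derivs_0[OF d] by fastforce
qed

lemma loop_fun_sobolev: "sobolev_circle CARD('k) (loop_fun (u :: ('k::finite, 'a::euclidean_space) sobolev_loop))"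
  using loop_fun[of u] by simp

lemma norm_loop_fun_le:
  fixes u :: "('k::finite, 'a::euclidean_space) sobolev_loop"
  shows "norm (loop_fun u s) \<le> 3 * (2 * pi + 1) * norm u"
proof (cases "u = 0")
  case True
  then show ?thesis by (simp add: zero_sobolev_loop.rep_eq)
next
  case False
  \<comment> \<open>By homogeneity a bound on the unit ball is enough; there \<open>x \<le> 1 + x\<^sup>2\<close> bounds the \<open>L\<^sup>1\<close> norms
    of the weak derivatives.\<close>
  define v where "v = inverse (norm u) *\<^sub>R u"
  have "norm v = 1" using False by (simp add: v_def)
  then have "sobolev_inner CARD('k) (loop_fun v) (loop_fun v) \<le> 1"
    by (simp add: norm_eq_sqrt_inner inner_sobolev_loop.rep_eq)
  then have "norm (loop_fun v s) \<le> 3 * (2 * pi + 1)"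
    by (rule sobolev_circle_bound[OF loop_fun_sobolev, rotated]) simp
  moreover have "u = norm u *\<^sub>R v" using False by (simp add: v_def)
  then have "norm (loop_fun u s) = norm u * norm (loop_fun v s)"
    by (metis norm_scaleR scaleR_sobolev_loop.rep_eq abs_norm_cancel)
  ultimately show ?thesis by (simp add: mult.commute mult_left_mono)
qed

lemma sup_embedding_loop_fun:
  assumes "rotation_invariant_measure \<mu>"
  shows "sup_embedding (loop_fun :: ('k::finite, 'a::euclidean_space) sobolev_loop \<Rightarrow> circle \<Rightarrow> 'a) \<mu>
    (3 * (2 * pi + 1))"
proof (rule sup_embedding.intro)
  fix a b :: "('k, 'a) sobolev_loop" and r :: real and s :: circle
  show "compact (UNIV :: circle set)" by (rule compact_circle)
  show "sets \<mu> = sets borel" "finite_measure \<mu>"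
    using assms unfolding rotation_invariant_measure_def by blast+
  show "loop_fun (a + b) s = loop_fun a s + loop_fun b s"
    by (simp add: plus_sobolev_loop.rep_eq)
  show "loop_fun (r *\<^sub>R a) s = r *\<^sub>R loop_fun a s"
    by (simp add: scaleR_sobolev_loop.rep_eq)
  show "continuous_on UNIV (loop_fun a)"
    by (intro continuous_at_imp_continuous_on ballI sobolev_circle_isCont[OF loop_fun_sobolev]) simp
  show "norm (loop_fun a s) \<le> 3 * (2 * pi + 1) * norm a" by (rule norm_loop_fun_le)
qed

section \<open>Charts of the manifold and of its loop space\<close>

lemma chart_inv_left: "complex_manifold A \<Longrightarrow> c \<in> A \<Longrightarrow> x \<in> fst c \<Longrightarrow> chart_inv c (snd c x) = x"
  by (simp add: complex_manifold_def homeomorphism_def)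

lemma chart_open:
  assumes "complex_manifold A" "c \<in> A"
  shows "open (fst c)" "open (snd c ` fst c)"
  using assms by (simp_all add: complex_manifold_def)

lemma open_chart_image:
  assumes M: "complex_manifold A" "c \<in> A" and W: "open W" "W \<subseteq> fst c"
  shows "open (snd c ` W)"
proof -
  have "continuous_on (snd c ` fst c) (chart_inv c)"
    using M by (auto simp: complex_manifold_def homeomorphism_def)
  then have "open ((snd c ` fst c) \<inter> chart_inv c -` W)"
    by (rule continuous_open_preimage[OF _ chart_open(2)[OF M] W(1)])
  moreover have "(snd c ` fst c) \<inter> chart_inv c -` W = snd c ` W"
    using W(2) chart_inv_left[OF M] by (auto simp: image_iff)
  ultimately show ?thesis by simp
qed

lemma transition_has_derivative:
  assumes "complex_manifold A" "c \<in> A" "c' \<in> A" "x \<in> fst c" "x \<in> fst c'"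
  shows "(transition c c' has_derivative frechet_derivative (transition c c') (at (snd c x))) (at (snd c x))"
proof -
  have "holomorphic_map_on (snd c ` (fst c \<inter> fst c')) (transition c c')"
    using assms by (simp add: complex_manifold_def)
  then have "transition c c' differentiable (at (snd c x))"
    using assms(4,5) unfolding holomorphic_map_on_def differentiable_def by blast
  then show ?thesis by (simp add: frechet_derivative_works)
qed

text \<open>Near \<open>z\<close> the map \<open>snd c' \<circ> g\<close> agrees with
  \<open>transition c c' \<circ> snd c \<circ> g\<close>. Keeping \<open>g\<close> general covers
  both chart inverses and the fibre slices of a loop chart.\<close>

lemma has_derivative_change_chart:
  assumes M: "complex_manifold A" "c \<in> A" "c' \<in> A"
    and N: "open N" "z \<in> N" "\<And>y. y \<in> N \<Longrightarrow> g y \<in> fst c" and z: "g z \<in> fst c'"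
    and D: "((\<lambda>y. snd c (g y)) has_derivative D) (at z)"
  shows "((\<lambda>y. snd c' (g y)) has_derivative
    (\<lambda>a. frechet_derivative (transition c c') (at (snd c (g z))) (D a))) (at z)"
proof -
  have "((\<lambda>y. transition c c' (snd c (g y))) has_derivative
      (\<lambda>a. frechet_derivative (transition c c') (at (snd c (g z))) (D a))) (at z)"
    by (rule has_derivative_compose[OF D transition_has_derivative[OF M N(3)[OF N(2)] z]])
  then show ?thesis
    by (rule has_derivative_transform_within_open[OF _ N(1,2)])
      (simp add: transition_def chart_inv_left[OF M(1,2)] N(3))
qed

text \<open>Compatibility between charts is the chain rule for transition maps. Membership gives
  access to the algebraic axioms of \<open>hermitian_metric\<close>, which concern vectors of
  \<open>tangent_space\<close> only.\<close>

lemma tvec_of_coords_tangent: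
  assumes M: "complex_manifold A" "c \<in> A" and x: "x \<in> fst c"
  shows "tvec_of_coords A c x a \<in> tangent_space A x"
  unfolding tangent_space_def
proof (intro CollectI conjI ballI allI impI)
  fix d d' assume d: "d \<in> A" "d' \<in> A" and "x \<in> fst d \<inter> fst d'"
  then have x': "x \<in> fst d" "x \<in> fst d'" by auto
  have xx: "chart_inv c (snd c x) = x" by (rule chart_inv_left[OF M x])
  have "((\<lambda>y. snd d' (chart_inv c y)) has_derivative
      (\<lambda>a. frechet_derivative (transition d d') (at (snd d (chart_inv c (snd c x))))
        (frechet_derivative (transition c d) (at (snd c x)) a))) (at (snd c x))"
  proof (rule has_derivative_change_chart[OF M(1) d, where N = "snd c ` (fst c \<inter> fst d)"])
    show "open (snd c ` (fst c \<inter> fst d))"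
      by (intro open_chart_image[OF M] open_Int chart_open[OF M] chart_open[OF M(1) d(1)]) auto
    show "((\<lambda>y. snd d (chart_inv c y)) has_derivative frechet_derivative (transition c d) (at (snd c x))) (at (snd c x))"
      using transition_has_derivative[OF M d(1) x x'(1)] by (simp add: transition_def comp_def)
  qed (use x x' xx chart_inv_left[OF M] in auto)
  then have "(transition c d' has_derivative
      (\<lambda>a. frechet_derivative (transition d d') (at (snd d x))
        (frechet_derivative (transition c d) (at (snd c x)) a))) (at (snd c x))"
    by (simp add: transition_def comp_def xx)
  then show "tvec_of_coords A c x a d' =
      frechet_derivative (transition d d') (at (snd d x)) (tvec_of_coords A c x a d)"
    using d x' by (simp add: tvec_of_coords_def flip: frechet_derivative_at)
next
  fix d assume "d \<notin> A \<or> x \<notin> fst d"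
  then show "tvec_of_coords A c x a d = 0" by (auto simp: tvec_of_coords_def)
qed

text \<open>Real scaling is turned into complex scaling, the form in which
  \<open>hermitian_metric\<close> states homogeneity.\<close>

lemma tvec_of_coords_linear:
  assumes M: "complex_manifold A" "c \<in> A" and x: "x \<in> fst c"
  shows "tvec_of_coords A c x (a + b) = (\<lambda>d. tvec_of_coords A c x a d + tvec_of_coords A c x b d)"
    and "tvec_of_coords A c x (r *\<^sub>R a) = (\<lambda>d. complex_of_real r *s tvec_of_coords A c x a d)"
proof -
  have "linear (frechet_derivative (transition c d) (at (snd c x)))" if "d \<in> A" "x \<in> fst d" for d
    using has_derivative_linear[OF transition_has_derivative[OF M that(1) x that(2)]] .
  then show "tvec_of_coords A c x (a + b) = (\<lambda>d. tvec_of_coords A c x a d + tvec_of_coords A c x b d)"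
    "tvec_of_coords A c x (r *\<^sub>R a) = (\<lambda>d. complex_of_real r *s tvec_of_coords A c x a d)"
    by (auto simp: tvec_of_coords_def fun_eq_iff linear_add linear_scale vec_eq_iff scaleR_conv_of_real[where 'a = complex])
qed

section \<open>Hermitian and Kaehler metrics in a single chart\<close>

lemma hermitian_metric_bilinear:
  assumes M: "complex_manifold A" "c \<in> A" and x: "x \<in> fst c" and h: "hermitian_metric A h"
  shows "bounded_bilinear (\<lambda>a b. h x (tvec_of_coords A c x a) (tvec_of_coords A c x b))"
proof -
  define t where "t = tvec_of_coords A c x"
  have T: "t a \<in> tangent_space A x" for a unfolding t_def by (rule tvec_of_coords_tangent[OF M x])
  note lin = tvec_of_coords_linear[OF M x, folded t_def]
  have add: "h x (t (a + b)) (t e) = h x (t a) (t e) + h x (t b) (t e)" for a b e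
    unfolding lin using h T unfolding hermitian_metric_def by blast
  have scale: "h x (t (r *\<^sub>R a)) (t e) = r *\<^sub>R h x (t a) (t e)" for a e r
  proof -
    have "h x (\<lambda>d. complex_of_real r *s t a d) (t e) = complex_of_real r * h x (t a) (t e)"
      using h T unfolding hermitian_metric_def by blast
    then show ?thesis by (simp add: lin scaleR_conv_of_real[where 'a = complex])
  qed
  \<comment> \<open>Linearity is postulated in the first argument; conjugate symmetry carries it to
    the second, where the form is conjugate-linear and hence still linear over the reals.\<close>
  have sym: "h x (t a) (t b) = cnj (h x (t b) (t a))" for a b
    using h T unfolding hermitian_metric_def by blast
  have "h x (t e) (t (a + b)) = h x (t e) (t a) + h x (t e) (t b)" for a b e
    using sym[of e "a + b"] sym[of e a] sym[of e b] add[of a b e] by simp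
  moreover have "h x (t e) (t (r *\<^sub>R a)) = r *\<^sub>R h x (t e) (t a)" for a e r
    using sym[of e "r *\<^sub>R a"] sym[of e a] scale[of r a e] by (simp add: scaleR_conv_of_real)
  ultimately have "bilinear (\<lambda>a b. h x (t a) (t b))"
    by (auto simp: bilinear_def linear_iff add scale)
  then show ?thesis by (simp add: bilinear_conv_bounded_bilinear t_def)
qed

lemma bounded_bilinear_neg_Im:
  assumes "bounded_bilinear (f :: 'a::real_normed_vector \<Rightarrow> 'b::real_normed_vector \<Rightarrow> complex)"
  shows "bounded_bilinear (\<lambda>a b. - Im (f a b))"
proof -
  interpret bounded_bilinear f by fact
  obtain K where K: "\<And>a b. norm (f a b) \<le> norm a * norm b * K" using bounded by blast
  show ?thesis
  proof
    show "\<exists>K. \<forall>a b. norm (- Im (f a b)) \<le> norm a * norm b * K"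
      using K abs_Im_le_cmod order_trans by (intro exI[of _ K]) (simp, blast)
  qed (simp_all add: add_left add_right scaleR_left scaleR_right)
qed

text \<open>Closedness supplies \<open>B\<close> and its derivative, but not continuity of that
  derivative; this is read off from the smooth coefficients of \<open>h\<close>. Antisymmetry is the
  imaginary part of Hermitian symmetry.\<close>

lemma kaehler_coords:
  fixes A :: "('x::{t2_space, second_countable_topology}, 'n::finite) chart set"
  assumes M: "complex_manifold A" and h: "hermitian_metric A h" and K: "kaehler A h" and c: "c \<in> A"
  obtains B :: "complex^'n \<Rightarrow> (complex^'n) \<Rightarrow>\<^sub>L (complex^'n) \<Rightarrow>\<^sub>L real" where
    "\<And>x a b. x \<in> fst c \<Longrightarrow>
      B (snd c x) a b = - Im (h x (tvec_of_coords A c x a) (tvec_of_coords A c x b))"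
    "\<And>y. y \<in> snd c ` fst c \<Longrightarrow> B differentiable (at y)"
    "\<And>y a b. y \<in> snd c ` fst c \<Longrightarrow> B y a b = - B y b a"
    "\<And>y a b e. y \<in> snd c ` fst c \<Longrightarrow> ext_deriv2 B y a b e = 0"
    "\<And>a b e. continuous_on (snd c ` fst c) (\<lambda>y. frechet_derivative B (at y) a b e)"
proof -
  let ?V = "snd c ` fst c"
  define k where "k = (\<lambda>a b y. h (chart_inv c y) (tvec_of_coords A c (chart_inv c y) a)
    (tvec_of_coords A c (chart_inv c y) b))"
  from bspec[OF K[unfolded kaehler_def closed_2form_def closed_2form_on_def fundamental_form_def Let_def] c]
  have "\<exists>B. (\<forall>y\<in>?V. \<forall>a b. blinfun_apply (blinfun_apply (B y) a) b = - Im (k a b y)) \<and>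
      (\<forall>y\<in>?V. B differentiable (at y)) \<and> (\<forall>y\<in>?V. \<forall>a b e. ext_deriv2 B y a b e = 0)"
    unfolding k_def .
  then obtain B where *: "\<forall>y\<in>?V. \<forall>a b. blinfun_apply (blinfun_apply (B y) a) b = - Im (k a b y)"
      "\<forall>y\<in>?V. B differentiable (at y)" "\<forall>y\<in>?V. \<forall>a b e. ext_deriv2 B y a b e = 0"
    by (elim exE conjE)
  note B = *(1)[rule_format] and dB = *(2)[rule_format] and closed = *(3)[rule_format]
  have k: "smooth_on ?V (k a b)" for a b
    using h c unfolding hermitian_metric_def Let_def k_def by blast
  show thesis
  proof
    show "B (snd c x) a b = - Im (h x (tvec_of_coords A c x a) (tvec_of_coords A c x b))"
      if "x \<in> fst c" for x a b
      using B[of "snd c x" a b] that by (simp add: k_def chart_inv_left[OF M c])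
    show "B differentiable (at y)" if "y \<in> ?V" for y by (rule dB[OF that])
    show "ext_deriv2 B y a b e = 0" if "y \<in> ?V" for y a b e by (rule closed[OF that])
    show "B y a b = - B y b a" if y: "y \<in> ?V" for y a b
    proof -
      obtain x where x: "x \<in> fst c" "y = snd c x" using y by blast
      have "h x (tvec_of_coords A c x b) (tvec_of_coords A c x a)
          = cnj (h x (tvec_of_coords A c x a) (tvec_of_coords A c x b))"
        using h tvec_of_coords_tangent[OF M c x(1)] unfolding hermitian_metric_def by blast
      then have "k b a y = cnj (k a b y)" by (simp add: k_def x chart_inv_left[OF M c])
      then show ?thesis by (simp add: B[OF y])
    qed
    show "continuous_on ?V (\<lambda>y. frechet_derivative B (at y) a b e)" for a b e
    proof (rule continuous_on_eq)
      show "continuous_on ?V (\<lambda>y. - Im (frechet_derivative (k b e) (at y) a))"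
        by (intro continuous_intros smooth_on_continuous_deriv[OF k])
      fix y assume y: "y \<in> ?V"
      have "((\<lambda>y. - Im (k b e y)) has_derivative (\<lambda>a. - Im (frechet_derivative (k b e) (at y) a))) (at y)"
        using smooth_on_differentiable[OF k y]
        by (auto simp: frechet_derivative_works intro!: derivative_eq_intros)
      then have "((\<lambda>y. B y b e) has_derivative (\<lambda>a. - Im (frechet_derivative (k b e) (at y) a))) (at y)"
        by (rule has_derivative_transform_within_open[OF _ chart_open(2)[OF M c] y]) (simp add: B)
      \<comment> \<open>The same scalar function is differentiated once as a coefficient of
        \<open>h\<close> and once through \<open>B\<close>; uniqueness identifies the
        results.\<close>
      moreover have "((\<lambda>y. B y b e) has_derivative (\<lambda>a. frechet_derivative B (at y) a b e)) (at y)"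
        using dB[OF y] by (intro bounded_linear.has_derivative[OF blinfun.bounded_linear_left])
          (simp add: frechet_derivative_works)
      ultimately show "- Im (frechet_derivative (k b e) (at y) a) = frechet_derivative B (at y) a b e"
        using has_derivative_unique by metis
    qed
  qed
qed

section \<open>Loop charts in coordinates of the manifold\<close>

definition loop_chart_vec ::
    "('x, 'n::finite) chart set \<Rightarrow> (circle \<times> (complex^'n) \<Rightarrow> 'x) \<Rightarrow> circle \<times> (complex^'n)
      \<Rightarrow> complex^'n \<Rightarrow> ('x, 'n) tvec" where
  "loop_chart_vec A \<Phi> p a = (\<lambda>c. if c \<in> A \<and> \<Phi> p \<in> fst c
    then frechet_derivative (\<lambda>z. snd c (\<Phi> (fst p, z))) (at (snd p)) a else 0)"

text \<open>The angle is a real number because \<open>smooth_on\<close> speaks about subsets of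
  normed spaces, which the circle is not.\<close>

definition loop_chart_dom :: "(circle \<times> (complex^'n)) set
      \<Rightarrow> (circle \<times> (complex^'n) \<Rightarrow> 'x) \<Rightarrow> ('x, 'n) chart \<Rightarrow> (real \<times> (complex^'n)) set" where
  "loop_chart_dom U \<Phi> c = {(t, z). (circle_exp t, z) \<in> U \<and> \<Phi> (circle_exp t, z) \<in> fst c}"

definition loop_chart_coords :: "(circle \<times> (complex^'n) \<Rightarrow> 'x) \<Rightarrow> ('x, 'n) chart
      \<Rightarrow> real \<times> (complex^'n) \<Rightarrow> complex^'n" where
  "loop_chart_coords \<Phi> c = (\<lambda>(t, z). snd c (\<Phi> (circle_exp t, z)))"

lemma loop_chart_dom_open:
  assumes M: "complex_manifold A" "c \<in> A" and L: "loop_chart A U \<Phi>"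
  shows "open (loop_chart_dom U \<Phi> c)"
proof -
  have "open (U \<inter> \<Phi> -` fst c)"
    using L chart_open(1)[OF M] by (auto simp: loop_chart_def intro: continuous_open_preimage)
  moreover have "continuous_on UNIV (\<lambda>p. (circle_exp (fst p), snd p :: complex^'b))"
    by (intro continuous_intros continuous_on_compose2[OF continuous_circle_exp[of UNIV]]) auto
  ultimately have "open ((\<lambda>p. (circle_exp (fst p), snd p)) -` (U \<inter> \<Phi> -` fst c))"
    by (rule open_vimage)
  moreover have "(\<lambda>p. (circle_exp (fst p), snd p)) -` (U \<inter> \<Phi> -` fst c) = loop_chart_dom U \<Phi> c"
    by (auto simp: loop_chart_dom_def)
  ultimately show ?thesis by simp
qed

lemma loop_chart_coords_smooth:
  assumes "loop_chart A U \<Phi>" "c \<in> A"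
  shows "smooth_on (loop_chart_dom U \<Phi> c) (loop_chart_coords \<Phi> c)"
  using assms by (simp add: loop_chart_def loop_chart_dom_def loop_chart_coords_def)

text \<open>By the chain rule, a vector given by its coordinates in all charts is recovered from
  those in the single chart \<open>c\<close>. This brings the loop chart into the setting of
  \<open>pullback_closed_2form\<close>, with \<open>(0, a)\<close> as fibre vector.\<close>

lemma loop_chart_vec_coords:
  assumes M: "complex_manifold A" "c \<in> A" and L: "loop_chart A U \<Phi>" and q: "(t, z) \<in> loop_chart_dom U \<Phi> c"
  shows "loop_chart_vec A \<Phi> (circle_exp t, z) a = tvec_of_coords A c (\<Phi> (circle_exp t, z))
    (frechet_derivative (loop_chart_coords \<Phi> c) (at (t, z)) (0, a))"
proof
  fix d
  let ?N = "(\<lambda>z. (t, z)) -` loop_chart_dom U \<Phi> c"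
  show "loop_chart_vec A \<Phi> (circle_exp t, z) a d = tvec_of_coords A c (\<Phi> (circle_exp t, z))
    (frechet_derivative (loop_chart_coords \<Phi> c) (at (t, z)) (0, a)) d"
  proof (cases "d \<in> A \<and> \<Phi> (circle_exp t, z) \<in> fst d")
    case True
    have "(loop_chart_coords \<Phi> c has_derivative frechet_derivative (loop_chart_coords \<Phi> c) (at (t, z))) (at (t, z))"
      using smooth_on_differentiable[OF loop_chart_coords_smooth[OF L M(2)] q]
      by (simp add: frechet_derivative_works)
    from slice_has_derivative[OF this]
    have D: "((\<lambda>z. snd c (\<Phi> (circle_exp t, z))) has_derivative
        (\<lambda>a. frechet_derivative (loop_chart_coords \<Phi> c) (at (t, z)) (0, a))) (at z)"
      by (simp add: loop_chart_coords_def)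
    have "((\<lambda>z. snd d (\<Phi> (circle_exp t, z))) has_derivative
        (\<lambda>a. frechet_derivative (transition c d) (at (snd c (\<Phi> (circle_exp t, z))))
          (frechet_derivative (loop_chart_coords \<Phi> c) (at (t, z)) (0, a)))) (at z)"
    proof (rule has_derivative_change_chart[OF M _ _ _ _ _ D, where N = ?N])
      show "open ?N" by (intro open_vimage loop_chart_dom_open[OF M L] continuous_intros)
    qed (use True q in \<open>auto simp: loop_chart_dom_def\<close>)
    then show ?thesis
      using True by (simp add: loop_chart_vec_def tvec_of_coords_def flip: frechet_derivative_at)
  qed (auto simp: loop_chart_vec_def tvec_of_coords_def)
qed

lemma loop_param_deriv_eq:
  "loop_param_deriv A \<Phi> u a s = loop_chart_vec A \<Phi> (s, loop_fun u s) (loop_fun a s)"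
  unfolding loop_param_deriv_def loop_chart_vec_def fst_conv snd_conv ..

lemma loop_chart_point:
  assumes "complex_manifold A" "p \<in> U"
  obtains t z c where "c \<in> A" "p = (circle_exp t, z)" "(t, z) \<in> loop_chart_dom U \<Phi> c"
proof -
  obtain s z where p: "p = (s, z)" by (cases p)
  obtain t where t: "s = circle_exp t" using circle_exp_surj by blast
  have "\<Phi> p \<in> (\<Union>c\<in>A. fst c)" using assms(1) by (simp add: complex_manifold_def)
  then obtain c where "c \<in> A" "\<Phi> p \<in> fst c" by blast
  then show thesis using that[of c t z] assms(2) by (simp add: p t loop_chart_dom_def)
qed

text \<open>Continuity is local: the sets \<open>loop_chart_dom U \<Phi> c\<close> are open and
  their images under \<open>circle_exp\<close> in the first coordinate cover \<open>U\<close>;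
  \<open>isCont_circle_prod\<close> descends from the angle to the circle.\<close>

lemma continuous_on_loop_chart:
  fixes f :: "circle \<times> (complex^'n::finite) \<Rightarrow> 'b::topological_space"
  assumes M: "complex_manifold A" and L: "loop_chart A U \<Phi>"
    and f: "\<And>c. c \<in> A \<Longrightarrow> continuous_on (loop_chart_dom U \<Phi> c) (\<lambda>q. f (circle_exp (fst q), snd q))"
  shows "continuous_on U f"
proof (intro continuous_at_imp_continuous_on ballI)
  fix p assume "p \<in> U"
  then obtain t z c where c: "c \<in> A" "p = (circle_exp t, z)" "(t, z) \<in> loop_chart_dom U \<Phi> c"
    using loop_chart_point[OF M] by blast
  have "isCont (\<lambda>q. f (circle_exp (fst q), snd q)) (t, z)"
    using f[OF c(1)] c(3) loop_chart_dom_open[OF M c(1) L] by (simp add: continuous_on_eq_continuous_at)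
  then show "isCont f p" unfolding c(2) by (rule isCont_circle_prod)
qed

section \<open>The pulled-back metric and two-form on the fibres of a loop chart\<close>

definition loop_chart_form ::
    "('x, 'n::finite) chart set \<Rightarrow> ('x \<Rightarrow> ('x, 'n) tvec \<Rightarrow> ('x, 'n) tvec \<Rightarrow> complex)
      \<Rightarrow> (circle \<times> (complex^'n) \<Rightarrow> 'x) \<Rightarrow> circle \<times> (complex^'n)
      \<Rightarrow> (complex^'n) \<Rightarrow>\<^sub>L (complex^'n) \<Rightarrow>\<^sub>L complex" where
  "loop_chart_form A h \<Phi> p = bilin (\<lambda>a b. h (\<Phi> p) (loop_chart_vec A \<Phi> p a) (loop_chart_vec A \<Phi> p b))"

definition loop_chart_omega ::
    "('x, 'n::finite) chart set \<Rightarrow> ('x \<Rightarrow> ('x, 'n) tvec \<Rightarrow> ('x, 'n) tvec \<Rightarrow> complex)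
      \<Rightarrow> (circle \<times> (complex^'n) \<Rightarrow> 'x) \<Rightarrow> circle \<times> (complex^'n)
      \<Rightarrow> (complex^'n) \<Rightarrow>\<^sub>L (complex^'n) \<Rightarrow>\<^sub>L real" where
  "loop_chart_omega A h \<Phi> p = bilin (\<lambda>a b. - Im (loop_chart_form A h \<Phi> p a b))"

lemma loop_chart_form_apply:
  assumes M: "complex_manifold A" and L: "loop_chart A U \<Phi>" and h: "hermitian_metric A h" and p: "p \<in> U"
  shows "loop_chart_form A h \<Phi> p a b = h (\<Phi> p) (loop_chart_vec A \<Phi> p a) (loop_chart_vec A \<Phi> p b)"
proof -
  obtain t z c where c: "c \<in> A" "p = (circle_exp t, z)" and q: "(t, z) \<in> loop_chart_dom U \<Phi> c"
    using loop_chart_point[OF M p] by blast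
  have "(loop_chart_coords \<Phi> c has_derivative frechet_derivative (loop_chart_coords \<Phi> c) (at (t, z))) (at (t, z))"
    using smooth_on_differentiable[OF loop_chart_coords_smooth[OF L c(1)] q]
    by (simp add: frechet_derivative_works)
  from has_derivative_bounded_linear[OF slice_has_derivative[OF this]]
  have lin: "bounded_linear (\<lambda>a. frechet_derivative (loop_chart_coords \<Phi> c) (at (t, z)) (0, a))" .
  have x: "\<Phi> p \<in> fst c" using q by (simp add: c(2) loop_chart_dom_def)
  show ?thesis unfolding loop_chart_form_def
    by (rule bilin_apply)
      (use bounded_bilinear.comp[OF hermitian_metric_bilinear[OF M c(1) x h] lin lin] in
        \<open>simp add: c(2) loop_chart_vec_coords[OF M c(1) L q]\<close>)
qed

lemma loop_chart_omega_apply: "loop_chart_omega A h \<Phi> p a b = - Im (loop_chart_form A h \<Phi> p a b)"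
  unfolding loop_chart_omega_def
  by (rule bilin_apply) (rule bounded_bilinear_neg_Im, rule bounded_bilinear.comp[OF bounded_bilinear_blinfun_apply,
      of "blinfun_apply (loop_chart_form A h \<Phi> p)" "\<lambda>b. b", OF blinfun.bounded_linear_right bounded_linear_ident])

text \<open>Serves the exchange of \<open>Im\<close> with the integral: over the compact circle,
  continuity makes the whole complex integrand integrable and not only its imaginary part.\<close>

lemma loop_chart_form_continuous:
  assumes M: "complex_manifold A" and L: "loop_chart A U \<Phi>" and h: "hermitian_metric A h"
  shows "continuous_on U (loop_chart_form A h \<Phi>)"
proof (rule continuous_on_loop_chart[OF M L])
  fix c assume c: "c \<in> A"
  let ?S = "loop_chart_dom U \<Phi> c" and ?F = "loop_chart_coords \<Phi> c" and ?V = "snd c ` fst c"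
  let ?h = "\<lambda>y a b. h (chart_inv c y) (tvec_of_coords A c (chart_inv c y) a)
      (tvec_of_coords A c (chart_inv c y) b)"
  have F: "smooth_on ?S ?F" by (rule loop_chart_coords_smooth[OF L c])
  define K where "K = (\<lambda>y. bilin (?h y))"
  have K: "K y a b = ?h y a b" if "y \<in> ?V" for y a b
    unfolding K_def using that chart_inv_left[OF M c]
    by (intro bilin_apply hermitian_metric_bilinear[OF M c _ h]) auto
  have "continuous_on ?V K"
  proof (intro continuous_on_blinfun_componentwise)
    fix i j
    have "smooth_on ?V (\<lambda>y. ?h y i j)"
      using h c unfolding hermitian_metric_def Let_def by blast
    then have "continuous_on ?V (\<lambda>y. ?h y i j)"
      by (intro continuous_at_imp_continuous_on ballI differentiable_imp_continuous_within smooth_on_differentiable)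
    then show "continuous_on ?V (\<lambda>y. K y i j)"
      by (rule continuous_on_eq) (simp add: K)
  qed
  moreover have "continuous_on ?S ?F"
    by (intro continuous_at_imp_continuous_on ballI differentiable_imp_continuous_within smooth_on_differentiable[OF F])
  ultimately have KF: "continuous_on ?S (\<lambda>q. K (?F q))"
    by (rule continuous_on_compose2) (auto simp: loop_chart_dom_def loop_chart_coords_def)
  show "continuous_on ?S (\<lambda>q. loop_chart_form A h \<Phi> (circle_exp (fst q), snd q))"
  proof (intro continuous_on_blinfun_componentwise)
    fix i j :: "complex^'b"
    have "continuous_on ?S (\<lambda>q. K (?F q) (frechet_derivative ?F (at q) (0, i)) (frechet_derivative ?F (at q) (0, j)))"
      by (intro continuous_intros KF smooth_on_continuous_deriv[OF F])
    then show "continuous_on ?S (\<lambda>q. loop_chart_form A h \<Phi> (circle_exp (fst q), snd q) i j)"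
    proof (rule continuous_on_eq)
      fix q assume q: "q \<in> ?S"
      obtain t z where tz: "q = (t, z)" by (cases q)
      have "(circle_exp t, z) \<in> U" "\<Phi> (circle_exp t, z) \<in> fst c" using q by (auto simp: tz loop_chart_dom_def)
      moreover from this have "?F q \<in> ?V" "chart_inv c (?F q) = \<Phi> (circle_exp t, z)"
        by (auto simp: tz loop_chart_coords_def chart_inv_left[OF M c])
      ultimately show "K (?F q) (frechet_derivative ?F (at q) (0, i)) (frechet_derivative ?F (at q) (0, j))
          = loop_chart_form A h \<Phi> (circle_exp (fst q), snd q) i j"
        using q by (simp add: K loop_chart_form_apply[OF M L h] loop_chart_vec_coords[OF M c L] tz)
    qed
  qed
qed

lemma loop_chart_omega_deriv:
  fixes A :: "('x::{t2_space, second_countable_topology}, 'n::finite) chart set"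
    and U :: "(circle \<times> (complex^'n)) set"
  assumes M: "complex_manifold A" and L: "loop_chart A U \<Phi>" and h: "hermitian_metric A h" and K: "kaehler A h"
  obtains \<beta>' :: "circle \<times> (complex^'n) \<Rightarrow> (complex^'n) \<Rightarrow>\<^sub>L (complex^'n) \<Rightarrow>\<^sub>L (complex^'n) \<Rightarrow>\<^sub>L real" where
    "continuous_on U (loop_chart_omega A h \<Phi>)" "continuous_on U \<beta>'"
    "\<And>s z. (s, z) \<in> U \<Longrightarrow>
      ((\<lambda>z. loop_chart_omega A h \<Phi> (s, z)) has_derivative \<beta>' (s, z)) (at z)"
    "\<And>p a b e. p \<in> U \<Longrightarrow> \<beta>' p a b e - \<beta>' p b a e + \<beta>' p e a b = 0"
proof -
  define \<beta> where "\<beta> = loop_chart_omega A h \<Phi>"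
  \<comment> \<open>Defined without reference to a chart \<open>c\<close>, so that the local
    statements over different charts are about the same function and fit together as they
    are.\<close>
  define \<beta>' where "\<beta>' = (\<lambda>p. Blinfun (frechet_derivative (\<lambda>z. \<beta> (fst p, z)) (at (snd p))))"
  have local: "(\<forall>p\<in>loop_chart_dom U \<Phi> c. ((\<lambda>z. \<beta> (circle_exp (fst p), z)) has_derivative
        \<beta>' (circle_exp (fst p), snd p)) (at (snd p))) \<and>
      continuous_on (loop_chart_dom U \<Phi> c) (\<lambda>q. \<beta> (circle_exp (fst q), snd q)) \<and>
      continuous_on (loop_chart_dom U \<Phi> c) (\<lambda>q. \<beta>' (circle_exp (fst q), snd q)) \<and>
      (\<forall>q\<in>loop_chart_dom U \<Phi> c. \<forall>a b e. \<beta>' (circle_exp (fst q), snd q) a b e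
        - \<beta>' (circle_exp (fst q), snd q) b a e + \<beta>' (circle_exp (fst q), snd q) e a b = 0)"
    if c: "c \<in> A" for c
  proof -
    let ?S = "loop_chart_dom U \<Phi> c" and ?F = "loop_chart_coords \<Phi> c"
    obtain B :: "complex^'n \<Rightarrow> (complex^'n) \<Rightarrow>\<^sub>L (complex^'n) \<Rightarrow>\<^sub>L real" where
      B: "\<And>x a b. x \<in> fst c \<Longrightarrow>
        B (snd c x) a b = - Im (h x (tvec_of_coords A c x a) (tvec_of_coords A c x b))"
      and B': "\<And>y. y \<in> snd c ` fst c \<Longrightarrow> B differentiable (at y)"
        "\<And>y a b. y \<in> snd c ` fst c \<Longrightarrow> B y a b = - B y b a"
        "\<And>y a b e. y \<in> snd c ` fst c \<Longrightarrow> ext_deriv2 B y a b e = 0"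
        "\<And>a b e. continuous_on (snd c ` fst c) (\<lambda>y. frechet_derivative B (at y) a b e)"
      by (rule kaehler_coords[OF M h K c]) (rule that)
    have FV: "?F ` ?S \<subseteq> snd c ` fst c" by (auto simp: loop_chart_dom_def loop_chart_coords_def)
    have "\<beta> (circle_exp (fst q), snd q) a b = B (?F q) (frechet_derivative ?F (at q) (0, a))
        (frechet_derivative ?F (at q) (0, b))" if q: "q \<in> ?S" for q a b
    proof -
      obtain t z where tz: "q = (t, z)" by (cases q)
      have "(circle_exp t, z) \<in> U" "\<Phi> (circle_exp t, z) \<in> fst c" using q by (auto simp: tz loop_chart_dom_def)
      then show ?thesis
        using q by (simp add: \<beta>_def loop_chart_omega_apply loop_chart_form_apply[OF M L h]
            loop_chart_vec_coords[OF M c L] tz B loop_chart_coords_def)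
    qed
    from pullback_closed_2form[where \<beta> = "\<lambda>q. \<beta> (circle_exp (fst q), snd q)",
        OF loop_chart_dom_open[OF M c L] loop_chart_coords_smooth[OF L c] FV B' this]
    show ?thesis unfolding \<beta>'_def fst_conv snd_conv by blast
  qed
  show thesis
  proof (rule that[of \<beta>'])
    show "continuous_on U (loop_chart_omega A h \<Phi>)" "continuous_on U \<beta>'"
      unfolding \<beta>_def[symmetric] by (rule continuous_on_loop_chart[OF M L], use local in blast)+
    fix p assume p: "p \<in> U"
    show "\<beta>' p a b e - \<beta>' p b a e + \<beta>' p e a b = 0" for a b e
    proof -
      obtain t z c where c: "c \<in> A" "p = (circle_exp t, z)" "(t, z) \<in> loop_chart_dom U \<Phi> c"
        using loop_chart_point[OF M p] by blast
      then show ?thesis using local[OF c(1)] by force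
    qed
  next
    fix s z assume p: "(s, z) \<in> U"
    obtain t z' c where c: "c \<in> A" "(s, z) = (circle_exp t, z')" "(t, z') \<in> loop_chart_dom U \<Phi> c"
      by (rule loop_chart_point[OF M p])
    have "((\<lambda>z. \<beta> (circle_exp t, z)) has_derivative \<beta>' (circle_exp t, z')) (at z')"
      using bspec[OF conjunct1[OF local[OF c(1)]] c(3)] by simp
    then show "((\<lambda>z. loop_chart_omega A h \<Phi> (s, z)) has_derivative \<beta>' (s, z)) (at z)"
      using c(2) by (simp add: \<beta>_def)
  qed
qed

theorem corollary1:
  fixes A :: "('x::{t2_space, second_countable_topology}, 'n::finite) chart set"
    and h :: "'x \<Rightarrow> ('x, 'n) tvec \<Rightarrow> ('x, 'n) tvec \<Rightarrow> complex"
    and \<mu> :: "circle measure"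
  assumes "complex_manifold A"
    and "hermitian_metric A h"
    and "rotation_invariant_measure \<mu>"
    and "kaehler A h"
  shows "loop_kaehler TYPE('k::finite) A (loop_metric \<mu> h)"
  unfolding loop_kaehler_def closed_loop_2form_def
proof (intro allI impI)
  fix U :: "(circle \<times> (complex^'n)) set" and \<Phi> :: "circle \<times> (complex^'n) \<Rightarrow> 'x"
  assume L: "loop_chart A U \<Phi>"
  let ?J = "loop_fun :: ('k, complex^'n) sobolev_loop \<Rightarrow> circle \<Rightarrow> complex^'n"
  let ?R = "loop_chart_range A U \<Phi> :: ('k, complex^'n) sobolev_loop set"
  interpret sup_embedding ?J \<mu> "3 * (2 * pi + 1)"
    by (rule sup_embedding_loop_fun[OF assms(3)])
  have U: "open U" using L by (simp add: loop_chart_def)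
  let ?\<beta> = "loop_chart_omega A h \<Phi>"
  obtain \<beta>' :: "circle \<times> (complex^'n) \<Rightarrow> (complex^'n) \<Rightarrow>\<^sub>L (complex^'n) \<Rightarrow>\<^sub>L (complex^'n) \<Rightarrow>\<^sub>L real" where
    d: "continuous_on U ?\<beta>" "continuous_on U \<beta>'"
    "\<And>s z. (s, z) \<in> U \<Longrightarrow> ((\<lambda>z. ?\<beta> (s, z)) has_derivative \<beta>' (s, z)) (at z)"
    "\<And>p a b e. p \<in> U \<Longrightarrow> \<beta>' p a b e - \<beta>' p b a e + \<beta>' p e a b = 0"
    by (rule loop_chart_omega_deriv[OF assms(1) L assms(2,4)]) (rule that)
  have graph: "(s, ?J u s) \<in> U" if "u \<in> ?R" for u s
    using that by (simp add: loop_chart_range_def)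
  have cont: "continuous_on UNIV (\<lambda>s. \<gamma> (s, ?J u s))"
    if "continuous_on U \<gamma>" "u \<in> ?R" for \<gamma> :: "circle \<times> (complex^'n) \<Rightarrow> 'd::topological_space" and u
    by (rule continuous_on_compose2[OF that(1)]) (auto intro!: continuous_intros J_cont graph that(2))
  \<comment> \<open>\<open>B\<close> is the expected form wherever the graph of \<open>u\<close> lies in \<open>U\<close>. As this condition on \<open>u\<close> is open,
    there is no need to know that the chart range is open.\<close>
  define B where "B = (\<lambda>u. integral_form (\<lambda>s. ?\<beta> (s, ?J u s)))"
  define D where "D = (\<lambda>u w. integral_form (\<lambda>s. \<beta>' (s, ?J u s) (?J w s)))"
  have dB: "(B has_derivative D u) (at u)" if "u \<in> ?R" for u
    unfolding B_def D_def
    by (rule has_derivative_integral_form[OF U d(1-3) graph[OF that]])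
  have D_apply: "D u a b e = (LINT s|\<mu>. \<beta>' (s, ?J u s) (?J a s) (?J b s) (?J e s))"
    and D_int: "integrable \<mu> (\<lambda>s. \<beta>' (s, ?J u s) (?J a s) (?J b s) (?J e s))" if u: "u \<in> ?R" for u a b e
  proof -
    \<comment> \<open>Contracting the derivative with the direction \<open>a\<close> leaves a
      continuous family of bilinear forms, to which the facts on \<open>integral_form\<close> apply
      again.\<close>
    have "continuous_on UNIV (\<lambda>s. \<beta>' (s, ?J u s) (?J a s))"
      by (intro continuous_intros cont d(2) u J_cont)
    then show "D u a b e = (LINT s|\<mu>. \<beta>' (s, ?J u s) (?J a s) (?J b s) (?J e s))"
      "integrable \<mu> (\<lambda>s. \<beta>' (s, ?J u s) (?J a s) (?J b s) (?J e s))"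
      unfolding D_def by (rule integral_form_apply integrable_form)+
  qed
  show "closed_2form_on ?R (\<lambda>u a b. fundamental_form (loop_metric \<mu> h) (loop_param \<Phi> u)
      (loop_param_deriv A \<Phi> u a) (loop_param_deriv A \<Phi> u b))"
    unfolding closed_2form_on_def
  proof (intro exI[of _ B] conjI ballI allI)
    fix u a b assume u: "u \<in> ?R"
    let ?k = "\<lambda>s. loop_chart_form A h \<Phi> (s, ?J u s) (?J a s) (?J b s)"
    \<comment> \<open>The integral of a non-integrable function is \<open>0\<close> by convention,
      so integrability of the complex integrand is what allows \<open>Im\<close> to be moved across
      the integral.\<close>
    have int: "integrable \<mu> ?k"
      by (intro integrable_continuous continuous_intros J_cont cont u loop_chart_form_continuous[OF assms(1) L assms(2)])
    have "B u a b = (LINT s|\<mu>. - Im (?k s))"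
      unfolding B_def by (subst integral_form_apply[OF cont[OF d(1) u]])
        (simp add: loop_chart_omega_apply)
    also have "\<dots> = - Im (LINT s|\<mu>. ?k s)" using int by simp
    also have "\<dots> = fundamental_form (loop_metric \<mu> h) (loop_param \<Phi> u)
        (loop_param_deriv A \<Phi> u a) (loop_param_deriv A \<Phi> u b)"
      by (simp add: fundamental_form_def loop_metric_def loop_param_def loop_param_deriv_eq
          loop_chart_form_apply[OF assms(1) L assms(2) graph[OF u]])
    finally show "B u a b = fundamental_form (loop_metric \<mu> h) (loop_param \<Phi> u)
        (loop_param_deriv A \<Phi> u a) (loop_param_deriv A \<Phi> u b)" .
  next
    fix u assume "u \<in> ?R"
    then show "B differentiable (at u)" using dB differentiableI by blast
  next
    fix u a b e assume u: "u \<in> ?R"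
    have "frechet_derivative B (at u) = D u" using frechet_derivative_at[OF dB[OF u]] by simp
    then have "ext_deriv2 B u a b e = (LINT s|\<mu>. \<beta>' (s, ?J u s) (?J a s) (?J b s) (?J e s)
        - \<beta>' (s, ?J u s) (?J b s) (?J a s) (?J e s) + \<beta>' (s, ?J u s) (?J e s) (?J a s) (?J b s))"
      by (simp add: ext_deriv2_def D_apply[OF u] D_int[OF u])
    also have "\<dots> = 0" by (simp add: d(4)[OF graph[OF u]])
    finally show "ext_deriv2 B u a b e = 0" .
  qed
qed

end
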